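(* Suppose $\sup_{\ell\ge1}\ell|a_\ell|<\infty$. Assume that for some $\ell^*\in\mathbb{N}$, $a_{\ell^*}>0$ and $a_\ell\ne a_{\ell^*}$ for all $\ell\neq\ell^*$. Then $\kappa^*:=2/a_{\ell^*}$ is a pitchfork bifurcation point of $F$ in the sense that there exist $\delta>0$ and a non-trivial branch of solutions $(\underline p(s),\kappa(s)):(-\delta,\delta)\to\ell^2_w\times\mathbb{R}_+$ such that $$\underline p(s)=s\,e_{\ell^*}+o(s)\quad (s\to0),$$ where $\{e_j\}_j$ is the canonical basis, and $\kappa(\cdot)$ is twice differentiable and satisfies $\kappa(0)=\kappa^*$, $\kappa'(0)=0$ and $$\kappa''(0)=\frac{2}{a_{\ell^*}}\cdot\frac{a_{\ell^*}-2a_{2\ell^*}}{a_{\ell^*}-a_{2\ell^*}}.$$ Moreover, in some neighborhood of $(\underline0,\kappa^* )$ in $\ell^2_w\times\mathbb{R}_+$, the points $(\underline p(s),\kappa(s))$ comprise the only non-trivial (i.e. $\underline p\neq\underline0$) solutions of $F(\underline p,\kappa)=\underline0$. Further, if $\kappa\notin\{2/a_\ell:\ell\in\mathbb{N}\}$, then $\kappa$ cannot be a bifurcation point (that is, $(\underline0,\kappa)$ is not a bifurcation point of $F$).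
   Context: $(a_\ell)_{\ell\ge1}$ are the real Fourier coefficients of an even, square integrable potential $W(\theta)=\sum_{\ell\ge1}a_\ell\cos\ell\theta$ on the circle $\mathbb{S}^1=[0,2\pi)$. $\mathbb{R}_+=(0,\infty)$. $\ell^2$ is the space of square summable real sequences indexed by $\mathbb{N}=\{1,2,\dots\}$ and $\ell^2_w=\{\underline x:\sum_{\ell\ge1}(1+\ell^2)x_\ell^2<\infty\}$ with norm $\|\underline x\|_w=(\sum(1+\ell^2)x_\ell^2)^{1/2}$. The map $F:\ell^2_w\times\mathbb{R}_+\to\ell^2$ is $$F_\ell(\underline x,\kappa)=\ell(2-\kappa a_\ell)x_\ell-\kappa\sum_{1\le j<\ell}ja_jx_jx_{\ell-j}-\kappa\sum_{j>\ell}\big(ja_j-(j-\ell)a_{j-\ell}\big)x_jx_{j-\ell},\quad \ell\ge1.$$ Zeros of $F(\cdot,\kappa)$ are exactly the Fourier modes $p_\ell=\frac1{2\pi}\int_0^{2\pi} p\cos\ell\theta\,d\theta$ of even $H^1$ probability densities $p$ (w.r.t. $d\theta/2\pi$) solving the stationary McKean-Vlasov equation $p''=\kappa(p(W\star p)')'$, $(W\star p)(\theta)=\frac1{2\pi}\int_0^{2\pi} W(\theta-\phi)p(\phi)d\phi$; $\underline 0$ is a zero for every $\kappa$. Bifurcation point: $(\underline p_b,\kappa_b)$ is a bifurcation point of $F$ if it lies in the closure of $\{(\underline p,\kappa)\in\ell^2_w\times\mathbb{R}_+:F(\underline p,\kappa)=\underline0,\ \underline p\ne\underline p_b,\ \kappa\neq\kappa_b\}$.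 A bifurcation curve at $(\underline p_b,\kappa_b)$ is a continuous curve $s\mapsto(\underline p(s),\kappa(s))$, $(-\delta,\delta)\to\ell^2_w\times\mathbb{R}_+$, with $(\underline p(0),\kappa(0))=(\underline p_b,\kappa_b)$ and $F(\underline p(s),\kappa(s))=\underline 0$ for all $s$; it is a non-trivial branch of solutions if it meets the axis $\{(\underline0,\kappa):\kappa\in\mathbb{R}_+\}$ at at most one $s$. *)

theory Defs
  imports "HOL-Analysis.Analysis" "HOL-Library.Landau_Symbols"
begin

text \<open>Sequences indexed by \<open>{1, 2, \<dots>}\<close> are represented as functions on \<open>nat\<close> with value \<open>0\<close>
  at the dummy index \<open>0\<close>.\<close>

typedef l2w = "{x :: nat \<Rightarrow> real. x 0 = 0 \<and> summable (\<lambda>l. (1 + (real l)\<^sup>2) * (x l)\<^sup>2)}"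
  morphisms coeff_l2w Abs_l2w
  by (rule exI[of _ "\<lambda>_. 0"]) simp

setup_lifting type_definition_l2w

lemma summable_l2w_mult:
  fixes x y :: "nat \<Rightarrow> real"
  assumes x: "summable (\<lambda>l. (1 + (real l)\<^sup>2) * (x l)\<^sup>2)"
    and y: "summable (\<lambda>l. (1 + (real l)\<^sup>2) * (y l)\<^sup>2)"
  shows "summable (\<lambda>l. (1 + (real l)\<^sup>2) * (x l * y l))"
proof (rule summable_comparison_test'[OF summable_add[OF x y]])
  fix l :: nat
  have "\<bar>x l * y l\<bar> \<le> (x l)\<^sup>2 + (y l)\<^sup>2"
  proof -
    have "0 \<le> (\<bar>x l\<bar> - \<bar>y l\<bar>)\<^sup>2" by simp
    hence "2 * \<bar>x l * y l\<bar> \<le> (x l)\<^sup>2 + (y l)\<^sup>2"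
      by (simp add: power2_diff abs_mult)
    thus ?thesis by linarith
  qed
  hence "(1 + (real l)\<^sup>2) * \<bar>x l * y l\<bar> \<le> (1 + (real l)\<^sup>2) * ((x l)\<^sup>2 + (y l)\<^sup>2)"
    by (intro mult_left_mono) auto
  thus "norm ((1 + (real l)\<^sup>2) * (x l * y l)) \<le> (1 + (real l)\<^sup>2) * (x l)\<^sup>2 + (1 + (real l)\<^sup>2) * (y l)\<^sup>2"
    by (simp only: real_norm_def abs_mult[of "1 + (real l)\<^sup>2"] distrib_left abs_of_nonneg
        add_nonneg_nonneg zero_le_one zero_le_power2)
qed

lemma summable_l2w_add:
  fixes x y :: "nat \<Rightarrow> real"
  assumes x: "summable (\<lambda>l. (1 + (real l)\<^sup>2) * (x l)\<^sup>2)"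
    and y: "summable (\<lambda>l. (1 + (real l)\<^sup>2) * (y l)\<^sup>2)"
  shows "summable (\<lambda>l. (1 + (real l)\<^sup>2) * (x l + y l)\<^sup>2)"
proof -
  have "summable (\<lambda>l. (1 + (real l)\<^sup>2) * (x l)\<^sup>2 + 2 * ((1 + (real l)\<^sup>2) * (x l * y l))
    + (1 + (real l)\<^sup>2) * (y l)\<^sup>2)"
    by (intro summable_add summable_mult summable_l2w_mult x y)
  thus ?thesis
    by (simp add: power2_sum algebra_simps)
qed

lemma summable_l2w_scale:
  fixes x :: "nat \<Rightarrow> real"
  assumes "summable (\<lambda>l. (1 + (real l)\<^sup>2) * (x l)\<^sup>2)"
  shows "summable (\<lambda>l. (1 + (real l)\<^sup>2) * (c * x l)\<^sup>2)"
  using summable_mult[OF assms, of "c\<^sup>2"] by (simp add: power_mult_distrib mult_ac)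

instantiation l2w :: real_vector
begin

lift_definition zero_l2w :: l2w is "\<lambda>_. 0" by simp

lift_definition plus_l2w :: "l2w \<Rightarrow> l2w \<Rightarrow> l2w" is "\<lambda>x y l. x l + y l"
  by (auto intro: summable_l2w_add)

lift_definition uminus_l2w :: "l2w \<Rightarrow> l2w" is "\<lambda>x l. - x l" by simp

lift_definition scaleR_l2w :: "real \<Rightarrow> l2w \<Rightarrow> l2w" is "\<lambda>c x l. c * x l"
  by (auto intro: summable_l2w_scale)

definition minus_l2w :: "l2w \<Rightarrow> l2w \<Rightarrow> l2w" where
  "x - y = x + - (y :: l2w)"

instance
  by standard (unfold minus_l2w_def, (transfer; force simp: algebra_simps)+)

end

instantiation l2w :: real_inner
begin

lift_definition inner_l2w :: "l2w \<Rightarrow> l2w \<Rightarrow> real" is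
  "\<lambda>x y. \<Sum>l. (1 + (real l)\<^sup>2) * (x l * y l)" .

text \<open>The summand at the dummy index \<open>0\<close> vanishes.\<close>
lift_definition norm_l2w :: "l2w \<Rightarrow> real" is
  "\<lambda>x. sqrt (\<Sum>l. (1 + (real l)\<^sup>2) * (x l)\<^sup>2)" .

definition sgn_l2w :: "l2w \<Rightarrow> l2w" where
  "sgn_l2w x = x /\<^sub>R norm x"

definition dist_l2w :: "l2w \<Rightarrow> l2w \<Rightarrow> real" where
  "dist_l2w x y = norm (x - y)"

definition uniformity_l2w :: "(l2w \<times> l2w) filter" where
  "uniformity_l2w = (INF e\<in>{0<..}. principal {(x, y). dist x y < e})"

definition open_l2w :: "l2w set \<Rightarrow> bool" where
  "open_l2w U \<longleftrightarrow> (\<forall>x\<in>U. \<forall>\<^sub>F (x', y) in uniformity. x' = x \<longrightarrow> y \<in> U)"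

instance
proof
  fix x y z :: l2w and r :: real and U :: "l2w set"
  show "dist x y = norm (x - y)" by (fact dist_l2w_def)
  show "sgn x = x /\<^sub>R norm x" by (fact sgn_l2w_def)
  show "uniformity = (INF e\<in>{0<..}. principal {(x, y :: l2w). dist x y < e})"
    by (fact uniformity_l2w_def)
  show "open U = (\<forall>x\<in>U. \<forall>\<^sub>F (x', y) in uniformity. x' = x \<longrightarrow> y \<in> U)"
    by (fact open_l2w_def)
  show "inner x y = inner y x"
    by transfer (simp add: mult_ac)
  show "inner (x + y) z = inner x z + inner y z"
  proof (transfer, elim CollectE conjE)
    fix x y z :: "nat \<Rightarrow> real"
    assume s: "summable (\<lambda>l. (1 + (real l)\<^sup>2) * (x l)\<^sup>2)"
      "summable (\<lambda>l. (1 + (real l)\<^sup>2) * (y l)\<^sup>2)"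
      "summable (\<lambda>l. (1 + (real l)\<^sup>2) * (z l)\<^sup>2)"
    show "(\<Sum>l. (1 + (real l)\<^sup>2) * ((x l + y l) * z l)) =
        (\<Sum>l. (1 + (real l)\<^sup>2) * (x l * z l)) + (\<Sum>l. (1 + (real l)\<^sup>2) * (y l * z l))"
      by (subst suminf_add[OF summable_l2w_mult[OF s(1,3)] summable_l2w_mult[OF s(2,3)]])
        (simp add: distrib_left distrib_right)
  qed
  show "inner (r *\<^sub>R x) y = r * inner x y"
  proof (transfer, elim CollectE conjE)
    fix r :: real and x y :: "nat \<Rightarrow> real"
    assume s: "summable (\<lambda>l. (1 + (real l)\<^sup>2) * (x l)\<^sup>2)"
      "summable (\<lambda>l. (1 + (real l)\<^sup>2) * (y l)\<^sup>2)"
    show "(\<Sum>l. (1 + (real l)\<^sup>2) * (r * x l * y l)) = r * (\<Sum>l. (1 + (real l)\<^sup>2) * (x l * y l))"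
      by (subst suminf_mult[OF summable_l2w_mult[OF s], symmetric]) (simp add: mult_ac)
  qed
  show "0 \<le> inner x x"
    by transfer (auto intro!: suminf_nonneg summable_l2w_mult)
  show "inner x x = 0 \<longleftrightarrow> x = 0"
  proof (transfer, safe)
    fix x :: "nat \<Rightarrow> real"
    assume s: "summable (\<lambda>l. (1 + (real l)\<^sup>2) * (x l)\<^sup>2)"
      and z: "(\<Sum>l. (1 + (real l)\<^sup>2) * (x l * x l)) = 0"
    have "\<forall>l. (1 + (real l)\<^sup>2) * (x l * x l) = 0"
      using suminf_eq_zero_iff[OF summable_l2w_mult[OF s s]] z by simp
    moreover have "1 + (real l)\<^sup>2 \<noteq> 0" for l
      by (smt (verit) zero_le_power2)
    ultimately show "x = (\<lambda>_. 0)" by (auto simp: fun_eq_iff)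
  qed auto
  show "norm x = sqrt (inner x x)"
    by transfer (simp add: power2_eq_square)
qed

end

lift_definition basis_l2w :: "nat \<Rightarrow> l2w" is
  "\<lambda>k l. if l = k \<and> 1 \<le> k then 1 else 0"
proof (intro CollectI conjI)
  fix k :: nat
  show "summable (\<lambda>l. (1 + (real l)\<^sup>2) * (if l = k \<and> 1 \<le> k then 1 else 0 :: real)\<^sup>2)"
    by (rule summable_finite[of "{k}"]) auto
qed auto

text \<open>\<open>W\<close> is an even, square integrable function on the circle (extended periodically to the
  line) with \<open>W(\<theta>) = \<Sum>l\<ge>1. a l * cos (l * \<theta>)\<close>, the series converging in \<open>L\<^sup>2\<close>. The value
  \<open>a 0\<close> plays no role.\<close>
definition even_L2_potential :: "(real \<Rightarrow> real) \<Rightarrow> (nat \<Rightarrow> real) \<Rightarrow> bool" where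
  "even_L2_potential W a \<longleftrightarrow>
     (\<forall>\<theta>. W (\<theta> + 2 * pi) = W \<theta>) \<and> (\<forall>\<theta>. W (- \<theta>) = W \<theta>) \<and>
     W \<in> borel_measurable lebesgue \<and>
     set_integrable lebesgue {0..<2 * pi} (\<lambda>\<theta>. (W \<theta>)\<^sup>2) \<and>
     (\<lambda>n. LINT \<theta>:{0..<2 * pi}|lebesgue. (W \<theta> - (\<Sum>l = 1..n. a l * cos (real l * \<theta>)))\<^sup>2)
       \<longlonglongrightarrow> 0"

text \<open>The components \<open>F\<^sub>l\<close>, as a raw sequence. If \<open>l * \<bar>a l\<bar>\<close> is bounded, the infinite sum converges
  absolutely and the sequence is square summable, so this is the map into \<open>\<ell>\<^sup>2\<close>.\<close>
definition F :: "(nat \<Rightarrow> real) \<Rightarrow> l2w \<Rightarrow> real \<Rightarrow> nat \<Rightarrow> real" where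
  "F a p \<kappa> l = (let x = coeff_l2w p in
     real l * (2 - \<kappa> * a l) * x l
     - \<kappa> * (\<Sum>j\<in>{1..<l}. real j * a j * x j * x (l - j))
     - \<kappa> * (\<Sum>\<^sub>\<infinity>j\<in>{l<..}. (real j * a j - real (j - l) * a (j - l)) * x j * x (j - l)))"

text \<open>\<open>(p, \<kappa>)\<close> belongs to the domain of \<open>F\<close>, where \<open>\<kappa>\<close> is positive, and is a zero.\<close>
definition is_solution :: "(nat \<Rightarrow> real) \<Rightarrow> l2w \<Rightarrow> real \<Rightarrow> bool" where
  "is_solution a p \<kappa> \<longleftrightarrow> \<kappa> > 0 \<and> (\<forall>l\<ge>1. F a p \<kappa> l = 0)"

definition bifurcation_point :: "(nat \<Rightarrow> real) \<Rightarrow> l2w \<Rightarrow> real \<Rightarrow> bool" where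
  "bifurcation_point a p\<^sub>b \<kappa>\<^sub>b \<longleftrightarrow> \<kappa>\<^sub>b > 0 \<and>
     (p\<^sub>b, \<kappa>\<^sub>b) \<in> closure {(p, \<kappa>). is_solution a p \<kappa> \<and> p \<noteq> p\<^sub>b \<and> \<kappa> \<noteq> \<kappa>\<^sub>b}"

definition bifurcation_curve ::
  "(nat \<Rightarrow> real) \<Rightarrow> l2w \<Rightarrow> real \<Rightarrow> real \<Rightarrow> (real \<Rightarrow> l2w) \<Rightarrow> (real \<Rightarrow> real) \<Rightarrow> bool" where
  "bifurcation_curve a p\<^sub>b \<kappa>\<^sub>b \<delta> p \<kappa> \<longleftrightarrow>
     continuous_on {-\<delta><..<\<delta>} (\<lambda>s. (p s, \<kappa> s)) \<and> p 0 = p\<^sub>b \<and> \<kappa> 0 = \<kappa>\<^sub>b \<and>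
     (\<forall>s\<in>{-\<delta><..<\<delta>}. is_solution a (p s) (\<kappa> s))"

definition nontrivial_branch ::
  "(nat \<Rightarrow> real) \<Rightarrow> l2w \<Rightarrow> real \<Rightarrow> real \<Rightarrow> (real \<Rightarrow> l2w) \<Rightarrow> (real \<Rightarrow> real) \<Rightarrow> bool" where
  "nontrivial_branch a p\<^sub>b \<kappa>\<^sub>b \<delta> p \<kappa> \<longleftrightarrow> bifurcation_curve a p\<^sub>b \<kappa>\<^sub>b \<delta> p \<kappa> \<and>
     (\<forall>s\<in>{-\<delta><..<\<delta>}. \<forall>t\<in>{-\<delta><..<\<delta>}. p s = 0 \<longrightarrow> p t = 0 \<longrightarrow> s = t)"

end

theory Submission
  imports Defs
begin

text \<open>
  Dividing \<open>F\<^sub>l(x, \<kappa>) = 0\<close> by \<open>\<kappa> l\<close> and putting \<open>\<mu> = 2 / \<kappa>\<close> gives the nonlinear eigenvalue problem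
  \<open>\<mu> x = D x + N(x, x)\<close>, where \<open>D\<close> is the diagonal operator with entries \<open>a\<^sub>l\<close> and \<open>N\<close> is a quadratic
  convolution term. Since \<open>l \<bar>a\<^sub>l\<bar>\<close> is bounded, \<open>N\<close> is a bounded bilinear map of the weighted
  sequence space into itself (\<open>bounded_bilinear_conv_l2w\<close>, \<open>is_solution_iff\<close>): it is an absolutely
  convergent series of shift operators, and it loses no derivative because of the division by \<open>l\<close>.

  The hypothesis on \<open>a\<close> says that \<open>a\<^sub>m\<close>, for \<open>m = lstar\<close>, is a simple eigenvalue of \<open>D\<close> with
  eigenvector \<open>e = e\<^sub>m\<close>; as \<open>a\<^sub>l \<rightarrow> 0\<close>, it is isolated in the spectrum, so the reduced resolvent \<open>S\<close>
  of \<open>D\<close> at \<open>a\<^sub>m\<close> is bounded. Let \<open>\<phi>\<close> be the \<open>m\<close>-th coordinate. For \<open>x = s u\<close> with \<open>s \<noteq> 0\<close>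
  and \<open>\<phi>(u) = 1\<close> the problem is equivalent to \<open>\<mu> = a\<^sub>m + s \<phi>(N(u, u))\<close> together with
  \<open>u = e + s S (N(u, u) - \<phi>(N(u, u)) u)\<close>. The second equation no longer contains \<open>\<mu>\<close> and is a
  regular perturbation of \<open>u = e\<close>: for small \<open>s\<close> it is a contraction, and its solution \<open>u(s)\<close> is
  twice differentiable (\<open>small_perturbation_of_constant\<close>). This gives the branch \<open>p(s) = s u(s)\<close>,
  \<open>\<kappa>(s) = 2 / \<mu>(s)\<close>. Conversely, applying \<open>S\<close> to the equation shows that any small nonzero solution
  is almost parallel to \<open>e\<close> (\<open>eventually_solution_in_cone\<close>), hence lies on the branch with
  \<open>s = \<phi>(x)\<close>.

  The derivatives of \<open>\<mu>\<close> at \<open>0\<close> are \<open>\<phi>(N(e, e)) = 0\<close> and \<open>2 \<phi>(N(e, w) + N(w, e))\<close>, where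
  \<open>w = u'(0)\<close> is the multiple \<open>a\<^sub>m / (2 (a\<^sub>m - a\<^sub>2\<^sub>m))\<close> of \<open>e\<^sub>2\<^sub>m\<close>; this yields the formula for
  \<open>\<kappa>''(0)\<close>. Finally, if \<open>2 / \<kappa>\<close> is not one of the \<open>a\<^sub>l\<close>, it lies in the resolvent set of \<open>D\<close>, and
  small solutions are trivial (\<open>eventually_only_trivial_solution\<close>).
\<close>

section \<open>Differentiability of fixed points of contractions\<close>

text \<open>The contraction constant absorbs the part of \<open>y s - y t\<close> that is transported by
  \<open>\<Phi> s\<close>; what is left is the variation of \<open>s \<mapsto> \<Phi> s (y t)\<close> with the second argument
  frozen.\<close>

lemma fixed_point_curve_isCont:
  fixes \<Phi> :: "real \<Rightarrow> 'a::real_normed_vector \<Rightarrow> 'a"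
  assumes fixp: "\<forall>\<^sub>F s in nhds t. y s = \<Phi> s (y s)"
    and lip: "\<forall>\<^sub>F s in nhds t. norm (\<Phi> s (y s) - \<Phi> s (y t)) \<le> c * norm (y s - y t)"
    and c: "c < 1"
    and cont: "isCont (\<lambda>s. \<Phi> s (y t)) t"
  shows "isCont y t"
proof -
  have t: "y t = \<Phi> t (y t)"
    using fixp by (rule eventually_nhds_x_imp_x)
  have "((\<lambda>s. norm (\<Phi> s (y t) - \<Phi> t (y t)) / (1 - c)) \<longlongrightarrow> 0 / (1 - c)) (at t)"
    using cont c unfolding isCont_def
    by (intro tendsto_intros tendsto_norm_zero LIM_zero) auto
  hence lim: "((\<lambda>s. norm (\<Phi> s (y t) - \<Phi> t (y t)) / (1 - c)) \<longlongrightarrow> 0) (at t)"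
    by simp
  have "\<forall>\<^sub>F s in nhds t. norm (y s - y t) \<le> norm (\<Phi> s (y t) - \<Phi> t (y t)) / (1 - c)"
    using fixp lip
  proof eventually_elim
    case (elim s)
    have "norm (y s - y t) = norm ((\<Phi> s (y s) - \<Phi> s (y t)) + (\<Phi> s (y t) - \<Phi> t (y t)))"
      using elim(1) t by simp
    also have "\<dots> \<le> c * norm (y s - y t) + norm (\<Phi> s (y t) - \<Phi> t (y t))"
      using elim(2) norm_triangle_ineq by (smt (verit))
    finally show ?case
      using c by (simp add: field_simps)
  qed
  hence "\<forall>\<^sub>F s in at t. norm (y s - y t) \<le> norm (\<Phi> s (y t) - \<Phi> t (y t)) / (1 - c)"
    by (simp add: eventually_at_filter eventually_mono)
  hence "((\<lambda>s. y s - y t) \<longlongrightarrow> 0) (at t)"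
    by (rule Lim_null_comparison[OF _ lim])
  thus ?thesis
    unfolding isCont_def by (rule LIM_zero_cancel)
qed

text \<open>Formal differentiation of \<open>y s = \<Phi> (s, y s)\<close> gives \<open>w = D (1, w)\<close>, and
  \<open>D (0, \<cdot>)\<close> being a contraction makes this equation uniquely solvable in a Banach space; the same
  contraction property shows that its solution is the derivative. Since
  \<open>\<Phi>\<close> is differentiated only at the point \<open>(t, y t)\<close>, the lemma also applies to the curve of
  derivatives, for which \<open>\<Phi>\<close> depends on \<open>s\<close> through \<open>y\<close> itself.\<close>

lemma fixed_point_curve_has_vector_derivative:
  fixes \<Phi> :: "real \<times> 'a::banach \<Rightarrow> 'a"
  assumes fixp: "\<forall>\<^sub>F s in nhds t. y s = \<Phi> (s, y s)"
    and cont: "isCont y t"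
    and D: "(\<Phi> has_derivative D) (at (t, y t))"
    and contr: "\<And>v. norm (D (0, v)) \<le> c * norm v" and c: "0 \<le> c" "c < 1"
  shows "\<exists>w. (y has_vector_derivative w) (at t) \<and> w = D (1, w)"
proof -
  interpret D: bounded_linear D
    using D by (rule has_derivative_bounded_linear)
  have D_split: "D (h, v) = h *\<^sub>R D (1, 0) + D (0, v)" for h v
  proof -
    have "D (h, v) = D (h *\<^sub>R (1, 0) + (0, v))" by simp
    thus ?thesis by (simp only: D.add D.scaleR)
  qed
  have "dist (D (1, v)) (D (1, w)) \<le> c * dist v w" for v w
    using contr[of "v - w"] D.diff[of "(1, v)" "(1, w)"] by (simp add: dist_norm)
  hence "\<exists>!w. D (1, w) = w"
    by (intro banach_fix_type[OF c]) blast
  then obtain w where w: "w = D (1, w)" by metis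
  have t: "y t = \<Phi> (t, y t)"
    using fixp by (rule eventually_nhds_x_imp_x)
  define K where "K = (norm w + 1) * 2 / (1 - c)"
  have "(y has_derivative (\<lambda>h. h *\<^sub>R w)) (at t)"
    unfolding has_derivative_at_alt
  proof (intro conjI allI impI)
    show "bounded_linear (\<lambda>h. h *\<^sub>R w)" by (rule bounded_linear_scaleR_left)
    fix e :: real assume e: "e > 0"
    \<comment> \<open>With \<open>\<rho> = y s - y t - (s - t) w\<close> the error of the linearisation satisfies
      \<open>\<rho> = D (0, \<rho>) + o(\<bar>s - t\<bar> + \<parallel>y s - y t\<parallel>)\<close>, and the last norm is at most
      \<open>\<parallel>\<rho>\<parallel> + \<bar>s - t\<bar> \<parallel>w\<parallel>\<close>; so \<open>\<parallel>\<rho>\<parallel>\<close> is absorbed on the left once the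
      factor \<open>\<eta>\<close> hidden in the \<open>o\<close> is at most \<open>(1 - c) / 2\<close>.\<close>
    define \<eta> where "\<eta> = min ((1 - c) / 2) (e * (1 - c) / (2 * (norm w + 1)))"
    have \<eta>: "\<eta> > 0" "\<eta> \<le> (1 - c) / 2" and "\<eta> \<le> e * (1 - c) / (2 * (norm w + 1))"
      unfolding \<eta>_def using c e by (simp add: add_nonneg_pos) (fact min.cobounded1 min.cobounded2)+
    hence \<eta>w: "\<eta> * (norm w + 1) \<le> e * (1 - c) / 2"
      using norm_ge_zero[of w] by (simp add: field_simps add_nonneg_pos)
    from D \<eta>(1) obtain d where d: "d > 0" and dD:
      "\<And>z. norm (z - (t, y t)) < d \<Longrightarrow>
         norm (\<Phi> z - \<Phi> (t, y t) - D (z - (t, y t))) \<le> \<eta> * norm (z - (t, y t))"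
      unfolding has_derivative_at_alt by blast
    have "((\<lambda>s. (s, y s)) \<longlongrightarrow> (t, y t)) (nhds t)"
      using cont by (intro tendsto_Pair filterlim_ident)
        (simp add: tendsto_at_iff_tendsto_nhds[symmetric] isCont_def)
    hence "\<forall>\<^sub>F s in nhds t. norm ((s, y s) - (t, y t)) < d"
      unfolding dist_norm[symmetric] using d by (rule tendstoD)
    with fixp have "\<forall>\<^sub>F s in nhds t. norm (y s - y t - (s - t) *\<^sub>R w) \<le> e * norm (s - t)"
    proof eventually_elim
      case (elim s)
      define \<rho> where "\<rho> = y s - y t - (s - t) *\<^sub>R w"
      have w': "(s - t) *\<^sub>R w = (s - t) *\<^sub>R D (1, 0) + D (0, (s - t) *\<^sub>R w)"
        using w D_split[of "s - t" "(s - t) *\<^sub>R w"] D.scaleR[of "s - t" "(1, w)"] by simp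
      have "D ((s, y s) - (t, y t)) = (s - t) *\<^sub>R D (1, 0) + D (0, y s - y t)"
        by (simp add: D_split[of "s - t"])
      also have "D (0, y s - y t) = D (0, \<rho>) + D (0, (s - t) *\<^sub>R w)"
        by (simp add: \<rho>_def D.add[symmetric])
      finally have lin: "D ((s, y s) - (t, y t)) = D (0, \<rho>) + (s - t) *\<^sub>R w"
        using w' by simp
      have "norm (\<rho> - D (0, \<rho>)) \<le> \<eta> * norm ((s, y s) - (t, y t))"
      proof -
        have "\<rho> - D (0, \<rho>) = \<Phi> (s, y s) - \<Phi> (t, y t) - D ((s, y s) - (t, y t))"
          unfolding lin elim(1)[symmetric] t[symmetric] by (simp add: \<rho>_def)
        thus ?thesis
          using dD[OF elim(2)] by simp
      qed
      also have "norm ((s, y s) - (t, y t)) \<le> norm (s - t) + norm (y s - y t)"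
        using norm_Pair_le[of "s - t" "y s - y t"] by simp
      also have "norm (y s - y t) \<le> norm \<rho> + norm (s - t) * norm w"
        using norm_triangle_ineq[of \<rho> "(s - t) *\<^sub>R w"] by (simp add: \<rho>_def)
      finally have "norm (\<rho> - D (0, \<rho>)) \<le> \<eta> * (norm \<rho> + norm (s - t) * (norm w + 1))"
        using \<eta>(1) by (simp add: algebra_simps)
      moreover have "norm \<rho> \<le> norm (\<rho> - D (0, \<rho>)) + c * norm \<rho>"
        using norm_triangle_sub[of \<rho> "D (0, \<rho>)"] contr[of \<rho>] by linarith
      moreover have "(2 * \<eta>) * norm \<rho> \<le> (1 - c) * norm \<rho>"
        using \<eta>(2) by (intro mult_right_mono) auto
      moreover have "(2 * (\<eta> * (norm w + 1))) * norm (s - t) \<le> (e * (1 - c)) * norm (s - t)"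
        using \<eta>w by (intro mult_right_mono) auto
      ultimately have "(1 - c) * norm \<rho> \<le> (1 - c) * (e * norm (s - t))"
        by (simp add: algebra_simps)
      thus ?case
        using c by (simp add: \<rho>_def)
    qed
    thus "\<exists>d>0. \<forall>s. norm (s - t) < d \<longrightarrow> norm (y s - y t - (s - t) *\<^sub>R w) \<le> e * norm (s - t)"
      by (simp add: eventually_nhds_metric dist_norm)
  qed
  with w show ?thesis
    unfolding has_vector_derivative_def by blast
qed

text \<open>For small \<open>s\<close> the map \<open>v \<mapsto> e + s P v\<close> is a contraction of a ball around \<open>e\<close>, and
  its fixed point \<open>u s\<close> is a differentiable curve. The derivative solves the linear equation
  \<open>w = P (u s) + s Q (u s) w\<close>, again a fixed point equation with a contraction, and therefore is
  itself differentiable. Joint differentiability of \<open>(u, w) \<mapsto> Q u w\<close> plays the part of twice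
  differentiability of \<open>P\<close> and avoids derivatives with values in a space of operators.\<close>

lemma small_perturbation_of_constant:
  fixes P :: "'a::banach \<Rightarrow> 'a" and Q :: "'a \<Rightarrow> 'a \<Rightarrow> 'a"
  assumes P: "\<And>u. (P has_derivative Q u) (at u)"
    and Q: "\<And>z. (\<lambda>z. Q (fst z) (snd z)) differentiable (at z)"
  obtains \<delta> r :: real and u u' :: "real \<Rightarrow> 'a"
  where "\<delta> > 0" "r > 0"
    and "\<And>s. \<bar>s\<bar> < \<delta> \<Longrightarrow> u s = e + s *\<^sub>R P (u s)"
    and "\<And>s v. \<bar>s\<bar> < \<delta> \<Longrightarrow> norm (v - e) \<le> r \<Longrightarrow> v = e + s *\<^sub>R P v \<Longrightarrow> v = u s"
    and "\<And>s. \<bar>s\<bar> < \<delta> \<Longrightarrow> (u has_vector_derivative u' s) (at s)"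
    and "\<And>s. \<bar>s\<bar> < \<delta> \<Longrightarrow> u' differentiable (at s)"
    and "u' 0 = P e"
proof -
  interpret Q: bounded_linear "Q u" for u
    using P by (rule has_derivative_bounded_linear)
  have contQ: "isCont (\<lambda>z. Q (fst z) (snd z)) z" for z
    using Q by (rule differentiable_imp_continuous_within)
  have contP: "isCont P u" for u
    using P by (rule has_derivative_continuous)
  \<comment> \<open>Joint continuity of \<open>Q\<close> at \<open>(e, 0)\<close> and linearity in the second argument bound the
    operators \<open>Q u\<close> uniformly for \<open>u\<close> near \<open>e\<close>.\<close>
  obtain r where r: "r > 0" and r': "\<And>u v. norm (u - e) \<le> r \<Longrightarrow> norm v \<le> r \<Longrightarrow> norm (Q u v) \<le> 1"
  proof -
    obtain d where d: "d > 0" "\<And>z. dist z (e, 0) < d \<Longrightarrow> norm (Q (fst z) (snd z)) < 1"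
      using contQ[of "(e, 0)", unfolded continuous_at_eps_delta, rule_format, OF zero_less_one]
      by auto
    have "norm (Q u v) \<le> 1" if "norm (u - e) \<le> d / 3" "norm v \<le> d / 3" for u v
    proof -
      have "dist (u, v) (e, 0) \<le> norm (u - e) + norm v"
        using norm_Pair_le[of "u - e" v] by (simp add: dist_norm)
      with that d(1) have "dist (u, v) (e, 0) < d" by simp
      from d(2)[OF this] show ?thesis by simp
    qed
    with d(1) show ?thesis by (intro that[of "d / 3"]) auto
  qed
  define K where "K = 1 / r"
  have K: "K > 0" using r by (simp add: K_def)
  have Qbound: "norm (Q u v) \<le> K * norm v" if u: "norm (u - e) \<le> r" for u v
  proof (cases "v = 0")
    case False
    have "norm (Q u ((r / norm v) *\<^sub>R v)) \<le> 1"
      using r u False by (intro r') auto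
    thus ?thesis
      using r False by (simp add: Q.scaleR K_def field_simps)
  qed simp
  have lipP: "norm (P u - P v) \<le> K * norm (u - v)" if "norm (u - e) \<le> r" "norm (v - e) \<le> r" for u v
  proof (rule differentiable_bound[where S = "cball e r"])
    show "(P has_derivative Q x) (at x within cball e r)" for x
      using P by (rule has_derivative_at_withinI)
    show "onorm (Q x) \<le> K" if "x \<in> cball e r" for x
      by (rule onorm_bound) (use that K Qbound in \<open>auto simp: dist_norm norm_minus_commute\<close>)
  qed (use that in \<open>auto simp: dist_norm norm_minus_commute\<close>)
  define M where "M = norm (P e) + K * r"
  have M: "M \<ge> 0" using K r by (simp add: M_def)
  have boundP: "norm (P u) \<le> M" if "norm (u - e) \<le> r" for u
  proof -
    have "norm (P u) \<le> norm (P e) + norm (P u - P e)"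
      using norm_triangle_sub by blast
    also have "norm (P u - P e) \<le> K * norm (u - e)"
      using that r by (intro lipP) auto
    also have "\<dots> \<le> K * r"
      using that K by (intro mult_left_mono) auto
    finally show ?thesis by (simp add: M_def)
  qed
  \<comment> \<open>The first bound makes \<open>v \<mapsto> e + s P v\<close> halve distances, the second one makes it map
    \<open>cball e r\<close> into itself.\<close>
  define \<delta> where "\<delta> = min (1 / (2 * K)) (r / (M + 1))"
  have \<delta>: "\<delta> > 0" using K M r by (simp add: \<delta>_def)
  have sK: "\<bar>s\<bar> * K \<le> 1 / 2" and sM: "\<bar>s\<bar> * M \<le> r" if "\<bar>s\<bar> < \<delta>" for s
  proof -
    from that K have "\<bar>s\<bar> \<le> 1 / (2 * K)" by (simp add: \<delta>_def)
    with K show "\<bar>s\<bar> * K \<le> 1 / 2" by (simp add: field_simps)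
    from that have "\<bar>s\<bar> \<le> r / (M + 1)" by (simp add: \<delta>_def)
    with M have "\<bar>s\<bar> * (M + 1) \<le> r" by (simp add: field_simps)
    thus "\<bar>s\<bar> * M \<le> r" by (simp add: algebra_simps)
  qed
  have contr: "norm (s *\<^sub>R P u - s *\<^sub>R P v) \<le> 1 / 2 * norm (u - v)"
    if "\<bar>s\<bar> < \<delta>" "norm (u - e) \<le> r" "norm (v - e) \<le> r" for s u v
  proof -
    have "norm (s *\<^sub>R P u - s *\<^sub>R P v) = \<bar>s\<bar> * norm (P u - P v)"
      by (simp flip: scaleR_diff_right)
    also have "\<dots> \<le> \<bar>s\<bar> * (K * norm (u - v))"
      using that by (intro mult_left_mono lipP) auto
    also have "\<dots> = (\<bar>s\<bar> * K) * norm (u - v)" by simp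
    also have "\<dots> \<le> 1 / 2 * norm (u - v)"
      using sK[OF that(1)] by (intro mult_right_mono) auto
    finally show ?thesis .
  qed
  have contrQ: "norm (s *\<^sub>R Q u v) \<le> 1 / 2 * norm v" if "\<bar>s\<bar> < \<delta>" "norm (u - e) \<le> r" for s u v
  proof -
    have "norm (s *\<^sub>R Q u v) \<le> \<bar>s\<bar> * (K * norm v)"
      using Qbound[OF that(2), of v] by (simp add: mult_left_mono)
    also have "\<dots> = (\<bar>s\<bar> * K) * norm v" by simp
    also have "\<dots> \<le> 1 / 2 * norm v"
      using sK[OF that(1)] by (intro mult_right_mono) auto
    finally show ?thesis .
  qed
  have ex1: "\<exists>!v. v \<in> cball e r \<and> e + s *\<^sub>R P v = v" if s: "\<bar>s\<bar> < \<delta>" for s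
  proof (rule Banach_fix[where c = "1 / 2"])
    show "(\<lambda>v. e + s *\<^sub>R P v) ` cball e r \<subseteq> cball e r"
    proof (safe, unfold mem_cball)
      fix v assume "dist e v \<le> r"
      hence "\<bar>s\<bar> * norm (P v) \<le> \<bar>s\<bar> * M"
        by (intro mult_left_mono boundP) (auto simp: dist_norm norm_minus_commute)
      also note sM[OF s]
      finally show "dist e (e + s *\<^sub>R P v) \<le> r" by (simp add: dist_norm)
    qed
    show "dist (e + s *\<^sub>R P v) (e + s *\<^sub>R P w) \<le> 1 / 2 * dist v w"
      if "v \<in> cball e r" "w \<in> cball e r" for v w
      using contr[OF s, of v w] that by (simp add: dist_norm norm_minus_commute)
  qed (use r in \<open>auto simp: complete_eq_closed\<close>)
  define u where "u s = (THE v. v \<in> cball e r \<and> e + s *\<^sub>R P v = v)" for s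
  have u: "norm (u s - e) \<le> r" "u s = e + s *\<^sub>R P (u s)" if "\<bar>s\<bar> < \<delta>" for s
    using theI'[OF ex1[OF that]] unfolding u_def[symmetric]
    by (simp_all add: dist_norm norm_minus_commute)
  have uniq: "v = u s" if "\<bar>s\<bar> < \<delta>" "norm (v - e) \<le> r" "v = e + s *\<^sub>R P v" for s v
    unfolding u_def using that
    by (intro the1_equality[OF ex1, symmetric] conjI) (simp_all add: dist_norm norm_minus_commute)
  have ev: "\<forall>\<^sub>F s in nhds t. \<bar>s\<bar> < \<delta>" if "\<bar>t\<bar> < \<delta>" for t
    using that by (intro order_tendstoD(2)[of abs "\<bar>t\<bar>"] tendsto_rabs filterlim_ident)
  have contu: "isCont u t" if t: "\<bar>t\<bar> < \<delta>" for t
  proof (rule fixed_point_curve_isCont[where \<Phi> = "\<lambda>s v. e + s *\<^sub>R P v" and c = "1 / 2"])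
    show "\<forall>\<^sub>F s in nhds t. u s = e + s *\<^sub>R P (u s)"
      using ev[OF t] by eventually_elim (rule u)
    show "\<forall>\<^sub>F s in nhds t. norm (e + s *\<^sub>R P (u s) - (e + s *\<^sub>R P (u t))) \<le> 1 / 2 * norm (u s - u t)"
      using ev[OF t] by eventually_elim (unfold add_diff_cancel_left, intro contr u t)
  qed (auto intro!: continuous_intros)
  have ex: "\<exists>w. (u has_vector_derivative w) (at t) \<and> w = P (u t) + t *\<^sub>R Q (u t) w"
    if t: "\<bar>t\<bar> < \<delta>" for t
  proof -
    have "\<exists>w. (u has_vector_derivative w) (at t) \<and>
        w = (\<lambda>h. t *\<^sub>R Q (u t) (snd h) + fst h *\<^sub>R P (u t)) (1, w)"
    proof (rule fixed_point_curve_has_vector_derivative[where c = "1 / 2"])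
      show "\<forall>\<^sub>F s in nhds t. u s = (\<lambda>z. e + fst z *\<^sub>R P (snd z)) (s, u s)"
        using ev[OF t] by eventually_elim (simp add: u(2)[symmetric])
      have "((\<lambda>z. P (snd z)) has_derivative (\<lambda>h. Q (u t) (snd h))) (at (t, u t))"
        using P[of "u t"] by (intro has_derivative_compose[where f = snd and g = P])
          (auto intro!: derivative_eq_intros)
      thus "((\<lambda>z. e + fst z *\<^sub>R P (snd z)) has_derivative
          (\<lambda>h. t *\<^sub>R Q (u t) (snd h) + fst h *\<^sub>R P (u t))) (at (t, u t))"
        by (auto intro!: derivative_eq_intros)
      show "norm ((\<lambda>h. t *\<^sub>R Q (u t) (snd h) + fst h *\<^sub>R P (u t)) (0, v)) \<le> 1 / 2 * norm v" for v
        using contrQ[OF t u(1)[OF t], of v] by simp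
    qed (use contu t in auto)
    thus ?thesis by (simp add: add.commute)
  qed
  define u' where "u' t = (SOME w. (u has_vector_derivative w) (at t) \<and> w = P (u t) + t *\<^sub>R Q (u t) w)" for t
  have u': "(u has_vector_derivative u' s) (at s)"
    and u'_eq: "u' s = P (u s) + s *\<^sub>R Q (u s) (u' s)" if "\<bar>s\<bar> < \<delta>" for s
    using someI_ex[OF ex[OF that]] unfolding u'_def[symmetric] by blast+
  have evu': "\<forall>\<^sub>F s in nhds t. u' s = P (u s) + s *\<^sub>R Q (u s) (u' s)" if t: "\<bar>t\<bar> < \<delta>" for t
    using ev[OF t] by eventually_elim (rule u'_eq)
  have contu': "isCont u' t" if t: "\<bar>t\<bar> < \<delta>" for t
  proof (rule fixed_point_curve_isCont[where \<Phi> = "\<lambda>s v. P (u s) + s *\<^sub>R Q (u s) v" and c = "1 / 2"])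
    show "\<forall>\<^sub>F s in nhds t. norm (P (u s) + s *\<^sub>R Q (u s) (u' s) - (P (u s) + s *\<^sub>R Q (u s) (u' t)))
        \<le> 1 / 2 * norm (u' s - u' t)"
      using ev[OF t]
    proof eventually_elim
      case (elim s)
      thus ?case
        using contrQ[OF elim u(1)[OF elim], of "u' s - u' t"] by (simp add: Q.diff scaleR_diff_right)
    qed
    have "isCont (\<lambda>s. P (u s)) t"
      using contu[OF t] contP by (rule isCont_o2)
    moreover have "isCont (\<lambda>s. Q (u s) (u' t)) t"
      using isCont_o2[OF isCont_Pair[OF contu[OF t] continuous_const[of "at t" "u' t"]] contQ] by simp
    ultimately show "isCont (\<lambda>s. P (u s) + s *\<^sub>R Q (u s) (u' t)) t"
      by (intro continuous_intros)
  qed (use evu' t in auto)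
  have "u' differentiable (at t)" if t: "\<bar>t\<bar> < \<delta>" for t
  proof -
    from Q[of "(u t, u' t)"] obtain D where
      D: "((\<lambda>z. Q (fst z) (snd z)) has_derivative D) (at (u t, u' t))"
      by (auto simp: differentiable_def)
    have DQ: "D (0, v) = Q (u t) v" for v
    proof -
      have "((\<lambda>v. (u t, v)) has_derivative (\<lambda>h. (0, h))) (at (u' t))"
        by (auto intro!: derivative_eq_intros)
      from has_derivative_compose[OF this D]
      have "(Q (u t) has_derivative (\<lambda>h. D (0, h))) (at (u' t))" by simp
      moreover have "(Q (u t) has_derivative Q (u t)) (at (u' t))"
        by (rule bounded_linear_imp_has_derivative) (rule Q.bounded_linear_axioms)
      ultimately show ?thesis
        by (rule has_derivative_unique[THEN fun_cong])
    qed
    have u'_t: "(u has_derivative (\<lambda>h. h *\<^sub>R u' t)) (at t)"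
      using u'[OF t] by (simp add: has_vector_derivative_def)
    have u'_fst: "((\<lambda>z. u (fst z)) has_derivative (\<lambda>h. fst h *\<^sub>R u' t)) (at (t, u' t))"
      by (rule has_derivative_compose[where f = fst and g = u])
        (use u'_t in \<open>auto intro!: derivative_eq_intros\<close>)
    have dP: "((\<lambda>z. P (u (fst z))) has_derivative (\<lambda>h. Q (u t) (fst h *\<^sub>R u' t))) (at (t, u' t))"
      using has_derivative_compose[OF u'_fst, of P] P[of "u t"] by simp
    have pair: "((\<lambda>z. (u (fst z), snd z)) has_derivative (\<lambda>h. (fst h *\<^sub>R u' t, snd h))) (at (t, u' t))"
      by (intro has_derivative_Pair u'_fst) (auto intro!: derivative_eq_intros)
    have dQ: "((\<lambda>z. Q (u (fst z)) (snd z)) has_derivative (\<lambda>h. D (fst h *\<^sub>R u' t, snd h))) (at (t, u' t))"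
      using has_derivative_compose[OF pair, of "\<lambda>z. Q (fst z) (snd z)"] D by simp
    have "\<exists>w. (u' has_vector_derivative w) (at t) \<and>
        w = (\<lambda>h. Q (u t) (fst h *\<^sub>R u' t) + (t *\<^sub>R D (fst h *\<^sub>R u' t, snd h) + fst h *\<^sub>R Q (u t) (u' t))) (1, w)"
    proof (rule fixed_point_curve_has_vector_derivative[where c = "1 / 2"])
      show "((\<lambda>z. P (u (fst z)) + fst z *\<^sub>R Q (u (fst z)) (snd z)) has_derivative
          (\<lambda>h. Q (u t) (fst h *\<^sub>R u' t) + (t *\<^sub>R D (fst h *\<^sub>R u' t, snd h) + fst h *\<^sub>R Q (u t) (u' t))))
          (at (t, u' t))"
        using dP dQ by (auto intro!: derivative_eq_intros)
      show "norm ((\<lambda>h. Q (u t) (fst h *\<^sub>R u' t) + (t *\<^sub>R D (fst h *\<^sub>R u' t, snd h)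
          + fst h *\<^sub>R Q (u t) (u' t))) (0, v)) \<le> 1 / 2 * norm v" for v
        using contrQ[OF t u(1)[OF t], of v] by (simp add: DQ Q.zero)
    qed (use contu' evu' t in auto)
    thus ?thesis
      by (auto simp: has_vector_derivative_def differentiable_def)
  qed
  moreover have "u' 0 = P e"
    using u'_eq[of 0] u(2)[of 0] \<delta> by simp
  ultimately show ?thesis
    using that[of \<delta> r u u'] \<delta> r u(2) uniq u' by blast
qed

section \<open>Bifurcation from a simple eigenvalue\<close>

lemma eventually_nhds_less:
  fixes f :: "'a::topological_space \<Rightarrow> real"
  assumes "continuous_on UNIV f" "f p < c"
  shows "\<forall>\<^sub>F q in nhds p. f q < c"
  using eventually_nhds_in_open[OF open_Collect_less[OF assms(1) continuous_on_const[of UNIV c]], of p]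
    assms(2) by simp

text \<open>Away from the spectrum of \<open>L\<close> the equation reads \<open>x = S (N x x - (\<mu> - \<mu>\<^sub>0) x)\<close>, and if
  \<open>x\<close> and \<open>\<mu> - \<mu>\<^sub>0\<close> are small but \<open>x \<noteq> 0\<close>, the norm of the right-hand side is less than \<open>\<parallel>x\<parallel>\<close>.\<close>

lemma eventually_only_trivial_solution:
  fixes L S :: "'a::real_normed_vector \<Rightarrow> 'a"
  assumes N: "bounded_bilinear N" and S: "bounded_linear S"
    and inv: "\<And>x. S (\<mu>\<^sub>0 *\<^sub>R x - L x) = x"
  shows "\<forall>\<^sub>F (x, \<mu>) in nhds (0, \<mu>\<^sub>0). \<mu> *\<^sub>R x = L x + N x x \<longrightarrow> x = 0"
proof -
  obtain C where C: "\<And>x y. norm (N x y) \<le> norm x * norm y * C"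
    using bounded_bilinear.bounded[OF N] by blast
  obtain K where K: "K \<ge> 0" "\<And>x. norm (S x) \<le> norm x * K"
    using bounded_linear.nonneg_bounded[OF S] by blast
  have "\<forall>\<^sub>F p in nhds (0, \<mu>\<^sub>0). K * (norm (fst p) * C + \<bar>snd p - \<mu>\<^sub>0\<bar>) < 1"
    by (rule eventually_nhds_less) (auto intro!: continuous_intros)
  thus ?thesis
    unfolding case_prod_beta
  proof eventually_elim
    case (elim p)
    obtain x \<mu> where p: "p = (x, \<mu>)" by force
    have "x = 0" if sol: "\<mu> *\<^sub>R x = L x + N x x"
    proof (rule ccontr)
      assume "x \<noteq> 0"
      have "\<mu>\<^sub>0 *\<^sub>R x - L x = N x x - (\<mu> - \<mu>\<^sub>0) *\<^sub>R x"
        using sol by (simp add: algebra_simps)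
      hence "norm x = norm (S (N x x - (\<mu> - \<mu>\<^sub>0) *\<^sub>R x))"
        using inv[of x] by simp
      also have "\<dots> \<le> (norm (N x x) + \<bar>\<mu> - \<mu>\<^sub>0\<bar> * norm x) * K"
        using K norm_triangle_ineq4[of "N x x" "(\<mu> - \<mu>\<^sub>0) *\<^sub>R x"]
        by (intro order_trans[OF K(2)] mult_right_mono) auto
      also have "\<dots> \<le> (norm x * norm x * C + \<bar>\<mu> - \<mu>\<^sub>0\<bar> * norm x) * K"
        using K(1) C by (intro mult_right_mono add_right_mono) auto
      also have "\<dots> = K * (norm x * C + \<bar>\<mu> - \<mu>\<^sub>0\<bar>) * norm x"
        by (simp add: algebra_simps)
      also have "\<dots> < 1 * norm x"
        using elim \<open>x \<noteq> 0\<close> by (intro mult_strict_right_mono) (auto simp: p)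
      finally show False by simp
    qed
    thus ?case by (simp add: p)
  qed
qed

text \<open>\<open>e\<close> is an eigenvector of \<open>L\<close> for the simple eigenvalue \<open>a\<close>, \<open>x \<mapsto> \<phi> x e\<close> is the spectral
  projection, and \<open>S\<close> is the reduced resolvent, that is, the inverse of \<open>a - L\<close> on the kernel of
  \<open>\<phi>\<close>, extended by zero to the span of \<open>e\<close>. The nonlinear eigenvalue problem is
  \<open>\<mu> x = L x + N x x\<close>.\<close>

locale simple_eigenvalue =
  L: bounded_linear L + S: bounded_linear S + \<phi>: bounded_linear \<phi> + N: bounded_bilinear N
  for L S :: "'a::banach \<Rightarrow> 'a" and \<phi> :: "'a \<Rightarrow> real" and N :: "'a \<Rightarrow> 'a \<Rightarrow> 'a" +
  fixes e :: 'a and a :: real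
  assumes L_e: "L e = a *\<^sub>R e" and \<phi>_e: "\<phi> e = 1"
    and \<phi>_L: "\<phi> (L x) = a * \<phi> x"
    and \<phi>_S: "\<phi> (S x) = 0"
    and S_left: "S (a *\<^sub>R x - L x) = x - \<phi> x *\<^sub>R e"
    and S_right: "a *\<^sub>R S x - L (S x) = x - \<phi> x *\<^sub>R e"
begin

lemma S_e: "S e = 0"
  using S_left[of "S e"] S_right[of e] by (simp add: \<phi>_e \<phi>_S S.zero)

text \<open>In the form \<open>x = s u\<close> with \<open>s \<noteq> 0\<close> and \<open>\<phi> u = 1\<close> the problem becomes \<open>\<mu> u = L u + s N u u\<close>. Its \<open>\<phi>\<close>
  component determines \<open>\<mu> = a + s \<phi> (N u u)\<close>; after this substitution, the complementary
  component is \<open>u = e + s branch_map u\<close>, so the unknown eigenvalue has disappeared and the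
  singular problem has become a regular perturbation of \<open>u = e\<close>.\<close>

definition branch_map :: "'a \<Rightarrow> 'a" where
  "branch_map u = S (N u u - \<phi> (N u u) *\<^sub>R u)"

definition branch_map_deriv :: "'a \<Rightarrow> 'a \<Rightarrow> 'a" where
  "branch_map_deriv u w = S (N u w + N w u - (\<phi> (N u u) *\<^sub>R w + \<phi> (N u w + N w u) *\<^sub>R u))"

lemma branch_map_has_derivative: "(branch_map has_derivative branch_map_deriv u) (at u)"
  unfolding branch_map_def[abs_def] branch_map_deriv_def[abs_def]
  by (auto intro!: derivative_eq_intros S.has_derivative \<phi>.has_derivative N.FDERIV)

lemma branch_map_deriv_differentiable: "(\<lambda>z. branch_map_deriv (fst z) (snd z)) differentiable (at z)"
  unfolding branch_map_deriv_def differentiable_def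
  by (rule exI) (rule S.has_derivative \<phi>.has_derivative N.FDERIV derivative_intros
      | rule has_derivative_add has_derivative_diff has_derivative_scaleR)+

lemma fixed_point_imp_solution:
  assumes u: "u = e + s *\<^sub>R branch_map u"
  shows "\<phi> u = 1" and "(a + s * \<phi> (N u u)) *\<^sub>R u = L u + s *\<^sub>R N u u"
proof -
  define y where "y = N u u - \<phi> (N u u) *\<^sub>R u"
  have u: "u = e + s *\<^sub>R S y"
    using u by (simp add: branch_map_def y_def)
  show "\<phi> u = 1"
    by (subst u) (simp add: \<phi>.add \<phi>.scaleR \<phi>_e \<phi>_S)
  hence y: "\<phi> y = 0"
    by (simp add: y_def \<phi>.diff \<phi>.scaleR)
  have "a *\<^sub>R u - L u = s *\<^sub>R (a *\<^sub>R S y - L (S y))"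
    by (subst (1 2) u) (simp add: L.add L.scaleR L_e algebra_simps)
  also have "\<dots> = s *\<^sub>R y"
    by (simp add: S_right y)
  finally show "(a + s * \<phi> (N u u)) *\<^sub>R u = L u + s *\<^sub>R N u u"
    by (simp add: y_def algebra_simps)
qed

lemma solution_imp_fixed_point:
  assumes sol: "\<mu> *\<^sub>R u = L u + s *\<^sub>R N u u" and "\<phi> u = 1"
  shows "\<mu> = a + s * \<phi> (N u u)" and "u = e + s *\<^sub>R branch_map u"
proof -
  have "\<phi> (\<mu> *\<^sub>R u) = \<phi> (L u + s *\<^sub>R N u u)"
    by (simp only: sol)
  thus \<mu>: "\<mu> = a + s * \<phi> (N u u)"
    using \<open>\<phi> u = 1\<close> by (simp add: \<phi>.add \<phi>.scaleR \<phi>_L)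
  have "a *\<^sub>R u - L u = s *\<^sub>R (N u u - \<phi> (N u u) *\<^sub>R u)"
    using sol unfolding \<mu> by (simp add: algebra_simps)
  hence "S (a *\<^sub>R u - L u) = s *\<^sub>R branch_map u"
    by (simp add: branch_map_def S.scaleR)
  thus "u = e + s *\<^sub>R branch_map u"
    using \<open>\<phi> u = 1\<close> by (simp add: S_left algebra_simps)
qed

text \<open>Every small solution is dominated by its component along \<open>e\<close>: applying \<open>S\<close> to the equation
  bounds the complementary part \<open>z\<close> by a multiple of \<open>\<parallel>x\<parallel>\<^sup>2\<close>. Hence \<open>\<phi> x \<noteq> 0\<close>, and the rescaled
  solution \<open>x / \<phi> x\<close> is so close to \<open>e\<close> that the uniqueness part of
  \<open>small_perturbation_of_constant\<close> applies to it.\<close>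

lemma eventually_solution_in_cone:
  assumes \<eta>: "\<eta> > 0"
  shows "\<forall>\<^sub>F (x, \<mu>) in nhds (0, a). \<mu> *\<^sub>R x = L x + N x x \<longrightarrow> x \<noteq> 0 \<longrightarrow>
    \<phi> x \<noteq> 0 \<and> \<bar>\<phi> x\<bar> < \<eta> \<and> norm (x /\<^sub>R \<phi> x - e) < \<eta>"
proof -
  obtain C where C: "C \<ge> 0" "\<And>x y. norm (N x y) \<le> norm x * norm y * C"
    using N.nonneg_bounded by blast
  obtain K where K: "K \<ge> 0" "\<And>x. norm (S x) \<le> norm x * K"
    using S.nonneg_bounded by blast
  define c where "c = 8 * K * C * (norm e)\<^sup>2"
  have cont: "continuous_on UNIV (\<lambda>p :: 'a \<times> real. \<phi> (fst p))"
    by (intro \<phi>.continuous_on continuous_intros)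
  have "\<forall>\<^sub>F p in nhds (0, a). \<bar>\<phi> (fst p)\<bar> < \<eta>"
    "\<forall>\<^sub>F p in nhds (0, a). c * \<bar>\<phi> (fst p)\<bar> < \<eta>"
    "\<forall>\<^sub>F p in nhds (0 :: 'a, a). 2 * K * C * norm (fst p) < 1 / 2"
    "\<forall>\<^sub>F p in nhds (0 :: 'a, a). K * \<bar>snd p - a\<bar> < 1 / 2"
    by (intro eventually_nhds_less continuous_intros cont; simp add: \<phi>.zero \<eta>)+
  thus ?thesis
    unfolding case_prod_beta
  proof eventually_elim
    case (elim p)
    obtain x \<mu> where p: "p = (x, \<mu>)" by force
    have "\<phi> x \<noteq> 0 \<and> norm (x /\<^sub>R \<phi> x - e) < \<eta>"
      if sol: "\<mu> *\<^sub>R x = L x + N x x" and "x \<noteq> 0"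
    proof -
      define z where "z = x - \<phi> x *\<^sub>R e"
      have "S x = S z"
        by (simp add: z_def S.diff S.scaleR S_e)
      moreover have "a *\<^sub>R x - L x = N x x - (\<mu> - a) *\<^sub>R x"
        using sol by (simp add: algebra_simps)
      ultimately have "z = S (N x x - (\<mu> - a) *\<^sub>R z)"
        using S_left[of x] by (simp add: z_def[symmetric] S.diff S.scaleR)
      hence "norm z \<le> norm (N x x - (\<mu> - a) *\<^sub>R z) * K"
        using K(2) by metis
      also have "\<dots> \<le> (norm x * norm x * C + \<bar>\<mu> - a\<bar> * norm z) * K"
        using K(1) C(2)[of x x] norm_triangle_ineq4[of "N x x" "(\<mu> - a) *\<^sub>R z"]
        by (intro mult_right_mono) auto
      also have "\<dots> = K * C * (norm x)\<^sup>2 + (K * \<bar>\<mu> - a\<bar>) * norm z"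
        by (simp add: algebra_simps power2_eq_square)
      also have "(K * \<bar>\<mu> - a\<bar>) * norm z \<le> 1 / 2 * norm z"
        using elim by (intro mult_right_mono) (auto simp: p)
      finally have z: "norm z \<le> 2 * K * C * (norm x)\<^sup>2"
        by simp
      also have "\<dots> = (2 * K * C * norm x) * norm x"
        by (simp add: power2_eq_square)
      also have "\<dots> \<le> 1 / 2 * norm x"
        using elim by (intro mult_right_mono) (auto simp: p)
      finally have x: "norm x \<le> 2 * (\<bar>\<phi> x\<bar> * norm e)"
        using norm_triangle_ineq[of z "\<phi> x *\<^sub>R e"] by (simp add: z_def)
      hence \<phi>x: "\<phi> x \<noteq> 0"
        using \<open>x \<noteq> 0\<close> by auto
      have "(norm x)\<^sup>2 \<le> (2 * (\<bar>\<phi> x\<bar> * norm e))\<^sup>2"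
        using x by (intro power_mono) auto
      hence "2 * K * C * (norm x)\<^sup>2 \<le> 2 * K * C * (2 * (\<bar>\<phi> x\<bar> * norm e))\<^sup>2"
        using K C by (intro mult_left_mono) auto
      with z have "norm z \<le> c * \<bar>\<phi> x\<bar> * \<bar>\<phi> x\<bar>"
        by (simp add: c_def power_mult_distrib algebra_simps power2_eq_square)
      hence "norm (z /\<^sub>R \<phi> x) \<le> c * \<bar>\<phi> x\<bar>"
        using \<phi>x by (simp add: field_simps)
      moreover have "z /\<^sub>R \<phi> x = x /\<^sub>R \<phi> x - e"
        using \<phi>x by (simp add: z_def scaleR_diff_right)
      ultimately show ?thesis
        using \<phi>x elim by (simp add: p)
    qed
    thus ?case using elim by (simp add: p)
  qed
qed

text \<open>Bifurcation from a simple eigenvalue. The branch is parametrised by its own \<open>\<phi>\<close> component,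
  since \<open>\<phi> (s u s) = s\<close>; this is what turns local uniqueness of \<open>u\<close> into the description of all
  small nonzero solutions.\<close>

theorem bifurcating_branch:
  obtains \<delta> :: real and u :: "real \<Rightarrow> 'a" and lam lam' :: "real \<Rightarrow> real"
  where "\<delta> > 0" "u 0 = e" "lam 0 = a"
    and "\<And>s. \<bar>s\<bar> < \<delta> \<Longrightarrow> \<phi> (u s) = 1"
    and "\<And>s. \<bar>s\<bar> < \<delta> \<Longrightarrow> isCont u s"
    and "\<And>s. \<bar>s\<bar> < \<delta> \<Longrightarrow> lam s *\<^sub>R (s *\<^sub>R u s) = L (s *\<^sub>R u s) + N (s *\<^sub>R u s) (s *\<^sub>R u s)"
    and "\<And>s. \<bar>s\<bar> < \<delta> \<Longrightarrow> (lam has_real_derivative lam' s) (at s)"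
    and "\<And>s. \<bar>s\<bar> < \<delta> \<Longrightarrow> lam' differentiable (at s)"
    and "lam' 0 = \<phi> (N e e)"
    and "(lam' has_real_derivative 2 * \<phi> (N e (branch_map e) + N (branch_map e) e)) (at 0)"
    and "\<forall>\<^sub>F (x, \<mu>) in nhds (0, a). \<mu> *\<^sub>R x = L x + N x x \<longrightarrow> x \<noteq> 0 \<longrightarrow>
          x = \<phi> x *\<^sub>R u (\<phi> x) \<and> \<mu> = lam (\<phi> x)"
proof -
  obtain \<delta> r u u' where \<delta>: "\<delta> > 0" and r: "r > 0"
    and u: "\<And>s. \<bar>s\<bar> < \<delta> \<Longrightarrow> u s = e + s *\<^sub>R branch_map (u s)"
    and uniq: "\<And>s v. \<bar>s\<bar> < \<delta> \<Longrightarrow> norm (v - e) \<le> r \<Longrightarrow> v = e + s *\<^sub>R branch_map v \<Longrightarrow> v = u s"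
    and u': "\<And>s. \<bar>s\<bar> < \<delta> \<Longrightarrow> (u has_vector_derivative u' s) (at s)"
    and u'': "\<And>s. \<bar>s\<bar> < \<delta> \<Longrightarrow> u' differentiable (at s)"
    and u'0: "u' 0 = branch_map e"
    by (rule small_perturbation_of_constant[OF branch_map_has_derivative branch_map_deriv_differentiable, of e], rule that)
  define lam where "lam s = a + s * \<phi> (N (u s) (u s))" for s
  define lam' where "lam' s = \<phi> (N (u s) (u s)) + s * \<phi> (N (u s) (u' s) + N (u' s) (u s))" for s
  have u0: "u 0 = e"
    using u[of 0] \<delta> by simp
  have du: "(u has_derivative (\<lambda>h. h *\<^sub>R u' s)) (at s)" if "\<bar>s\<bar> < \<delta>" for s
    using u'[OF that] by (simp add: has_vector_derivative_def)
  have dN: "((\<lambda>s. \<phi> (N (u s) (u s))) has_real_derivative \<phi> (N (u s) (u' s) + N (u' s) (u s))) (at s)"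
    if s: "\<bar>s\<bar> < \<delta>" for s
  proof -
    have "((\<lambda>s. \<phi> (N (u s) (u s))) has_derivative
        (\<lambda>h. \<phi> (N (u s) (h *\<^sub>R u' s) + N (h *\<^sub>R u' s) (u s)))) (at s)"
      by (intro \<phi>.has_derivative N.FDERIV du s)
    thus ?thesis
      unfolding has_field_derivative_def
      by (rule has_derivative_eq_rhs) (simp add: fun_eq_iff N.scaleR_left N.scaleR_right \<phi>.scaleR \<phi>.add algebra_simps)
  qed
  have dlam: "(lam has_real_derivative lam' s) (at s)" if s: "\<bar>s\<bar> < \<delta>" for s
    unfolding lam_def[abs_def] lam'_def by (auto intro!: derivative_eq_intros dN s)
  have dlam': "(lam' has_real_derivative
      2 * \<phi> (N (u s) (u' s) + N (u' s) (u s)) +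
      s * \<phi> (N (u s) w + N (u' s) (u' s) + (N (u' s) (u' s) + N w (u s)))) (at s)"
    if s: "\<bar>s\<bar> < \<delta>" and w: "(u' has_derivative (\<lambda>h. h *\<^sub>R w)) (at s)" for s w
  proof -
    have "((\<lambda>s. \<phi> (N (u s) (u' s) + N (u' s) (u s))) has_derivative
        (\<lambda>h. \<phi> (N (u s) (h *\<^sub>R w) + N (h *\<^sub>R u' s) (u' s) + (N (u' s) (h *\<^sub>R u' s) + N (h *\<^sub>R w) (u s))))) (at s)"
      by (intro \<phi>.has_derivative N.FDERIV has_derivative_add du s w)
    hence "((\<lambda>s. \<phi> (N (u s) (u' s) + N (u' s) (u s))) has_real_derivative
        \<phi> (N (u s) w + N (u' s) (u' s) + (N (u' s) (u' s) + N w (u s)))) (at s)"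
      unfolding has_field_derivative_def
      by (rule has_derivative_eq_rhs) (simp add: fun_eq_iff N.scaleR_left N.scaleR_right \<phi>.scaleR \<phi>.add algebra_simps)
    from DERIV_add[OF dN[OF s] DERIV_mult[OF DERIV_ident this]] show ?thesis
      by (simp add: lam'_def[abs_def] algebra_simps)
  qed
  have ex_w: "\<exists>w. (u' has_derivative (\<lambda>h. h *\<^sub>R w)) (at s)" if "\<bar>s\<bar> < \<delta>" for s
    using u''[OF that] vector_derivative_works[of u' "at s"]
    by (auto simp: has_vector_derivative_def)
  show ?thesis
  proof (rule that[of \<delta> u lam lam'])
    fix s :: real assume s: "\<bar>s\<bar> < \<delta>"
    note sol = fixed_point_imp_solution[OF u[OF s]]
    show "\<phi> (u s) = 1" by (rule sol)
    show "isCont u s"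
      using du[OF s] by (rule has_derivative_continuous)
    have "lam s *\<^sub>R u s = L (u s) + s *\<^sub>R N (u s) (u s)"
      unfolding lam_def by (rule sol)
    from arg_cong[OF this, of "\<lambda>x. s *\<^sub>R x"]
    show "lam s *\<^sub>R (s *\<^sub>R u s) = L (s *\<^sub>R u s) + N (s *\<^sub>R u s) (s *\<^sub>R u s)"
      by (simp add: L.scaleR N.scaleR_left N.scaleR_right scaleR_add_right mult.commute)
    show "(lam has_real_derivative lam' s) (at s)"
      by (rule dlam) fact
    show "lam' differentiable (at s)"
      using ex_w[OF s] dlam'[OF s] by (meson real_differentiable_def)
  next
    from ex_w[of 0] \<delta> obtain w where "(u' has_derivative (\<lambda>h. h *\<^sub>R w)) (at 0)" by auto
    from dlam'[OF _ this] \<delta> show "(lam' has_real_derivative 2 * \<phi> (N e (branch_map e) + N (branch_map e) e)) (at 0)"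
      by (simp add: u0 u'0)
    show "\<forall>\<^sub>F (x, \<mu>) in nhds (0, a). \<mu> *\<^sub>R x = L x + N x x \<longrightarrow> x \<noteq> 0 \<longrightarrow>
          x = \<phi> x *\<^sub>R u (\<phi> x) \<and> \<mu> = lam (\<phi> x)"
      using eventually_solution_in_cone[of "min \<delta> r", simplified, OF conjI[OF \<delta> r]]
      unfolding case_prod_beta
    proof eventually_elim
      case (elim p)
      obtain x \<mu> where p: "p = (x, \<mu>)" by force
      have "x = \<phi> x *\<^sub>R u (\<phi> x) \<and> \<mu> = lam (\<phi> x)"
        if sol: "\<mu> *\<^sub>R x = L x + N x x" and "x \<noteq> 0"
      proof -
        define s where "s = \<phi> x"
        define v where "v = x /\<^sub>R s"
        have s: "s \<noteq> 0" "\<bar>s\<bar> < \<delta>" and v: "norm (v - e) \<le> r"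
          using elim that by (auto simp: p s_def v_def)
        have x: "x = s *\<^sub>R v"
          using s by (simp add: v_def)
        have "s *\<^sub>R (\<mu> *\<^sub>R v) = s *\<^sub>R (L v + s *\<^sub>R N v v)"
          using sol unfolding x
          by (simp add: L.scaleR N.scaleR_left N.scaleR_right scaleR_add_right mult.commute)
        hence "\<mu> *\<^sub>R v = L v + s *\<^sub>R N v v"
          using s by (simp only: scaleR_cancel_left) simp
        moreover have "\<phi> v = 1"
          using s by (simp add: v_def \<phi>.scaleR s_def)
        ultimately have v': "\<mu> = a + s * \<phi> (N v v)" "v = e + s *\<^sub>R branch_map v"
          by (rule solution_imp_fixed_point)+
        from uniq[OF s(2) v v'(2)] have "v = u s" .
        hence "x = s *\<^sub>R u s \<and> \<mu> = lam s"
          using x v'(1) by (simp only: lam_def)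
        thus ?thesis by (simp only: s_def)
      qed
      thus ?case by (simp add: p)
    qed
  qed (use \<delta> u0 in \<open>auto simp: lam_def lam'_def\<close>)
qed

end

section \<open>The weighted sequence space as a Banach space\<close>

lemmas coeff_l2w_simps [simp] =
  zero_l2w.rep_eq plus_l2w.rep_eq uminus_l2w.rep_eq scaleR_l2w.rep_eq

lemma coeff_l2w_minus [simp]: "coeff_l2w (x - y) l = coeff_l2w x l - coeff_l2w y l"
  unfolding minus_l2w_def by (simp only: coeff_l2w_simps diff_conv_add_uminus)

lemma coeff_l2w_0 [simp]: "coeff_l2w x 0 = 0"
  using coeff_l2w[of x] by simp

lemma l2w_eqI: "(\<And>l. l \<ge> 1 \<Longrightarrow> coeff_l2w x l = coeff_l2w y l) \<Longrightarrow> x = y"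
  by (metis coeff_l2w_0 coeff_l2w_inject ext less_one linorder_not_less)

lemma summable_coeff_l2w: "summable (\<lambda>l. (1 + (real l)\<^sup>2) * (coeff_l2w x l)\<^sup>2)"
  using coeff_l2w[of x] by simp

lemma norm_l2w_power2: "(norm x)\<^sup>2 = (\<Sum>l. (1 + (real l)\<^sup>2) * (coeff_l2w x l)\<^sup>2)"
  by (simp add: norm_l2w.rep_eq suminf_nonneg[OF summable_coeff_l2w])

lemma summable_coeff_l2w_power2: "summable (\<lambda>l. (coeff_l2w x l)\<^sup>2)"
  by (rule summable_comparison_test'[OF summable_coeff_l2w[of x], of 0])
    (simp add: algebra_simps)

lemma suminf_coeff_l2w_power2_le: "(\<Sum>l. (coeff_l2w x l)\<^sup>2) \<le> (norm x)\<^sup>2"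
  unfolding norm_l2w_power2
  by (rule suminf_le[OF _ summable_coeff_l2w_power2 summable_coeff_l2w]) (simp add: algebra_simps)

lemma abs_coeff_l2w_le: "\<bar>coeff_l2w x l\<bar> \<le> norm x"
proof -
  have "(\<Sum>i\<in>{l}. (coeff_l2w x i)\<^sup>2) \<le> (\<Sum>i. (coeff_l2w x i)\<^sup>2)"
    by (rule sum_le_suminf[OF summable_coeff_l2w_power2]) auto
  hence "(coeff_l2w x l)\<^sup>2 \<le> (norm x)\<^sup>2"
    using suminf_coeff_l2w_power2_le[of x] by simp
  thus ?thesis
    by (simp add: abs_le_square_iff[symmetric])
qed

lemma bounded_linear_coeff_l2w: "bounded_linear (\<lambda>x. coeff_l2w x l)"
  by (rule bounded_linear_intro[where K = 1]) (auto simp: abs_coeff_l2w_le)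

text \<open>\<open>Abs_l2w f\<close> is meaningful only if \<open>f\<close> has finite weighted norm; the comparison with \<open>g\<close>
  settles this together with a bound on the norm.\<close>

lemma l2w_dominated:
  fixes f g :: "nat \<Rightarrow> real"
  assumes f0: "f 0 = 0" and dom: "\<And>l. (1 + (real l)\<^sup>2) * (f l)\<^sup>2 \<le> g l" and g: "summable g"
  shows "coeff_l2w (Abs_l2w f) = f" "(norm (Abs_l2w f))\<^sup>2 \<le> suminf g"
proof -
  have s: "summable (\<lambda>l. (1 + (real l)\<^sup>2) * (f l)\<^sup>2)"
    by (rule summable_comparison_test'[OF g, of 0]) (use dom in \<open>simp add: abs_mult\<close>)
  with f0 show eq: "coeff_l2w (Abs_l2w f) = f"
    by (simp add: Abs_l2w_inverse)
  show "(norm (Abs_l2w f))\<^sup>2 \<le> suminf g"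
    unfolding norm_l2w_power2 eq by (rule suminf_le[OF dom s g])
qed

text \<open>A Cauchy sequence converges in every coordinate; the bounds on the partial sums of the
  squared distances survive the passage to the coordinatewise limit.\<close>

instance l2w :: complete_space
proof
  fix X :: "nat \<Rightarrow> l2w" assume X: "Cauchy X"
  define y where "y l = lim (\<lambda>n. coeff_l2w (X n) l)" for l
  have lim: "(\<lambda>n. coeff_l2w (X n) l) \<longlonglongrightarrow> y l" for l
    using bounded_linear.Cauchy[OF bounded_linear_coeff_l2w X, of l]
    unfolding y_def by (simp add: Cauchy_convergent_iff convergent_LIMSEQ_iff)
  have partial: "\<exists>n0. \<forall>n\<ge>n0. \<forall>L. (\<Sum>l<L. (1 + (real l)\<^sup>2) * (coeff_l2w (X n) l - y l)\<^sup>2) \<le> e\<^sup>2"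
    if e: "e > 0" for e
  proof -
    from X e obtain n0 where n0: "\<And>n k. n \<ge> n0 \<Longrightarrow> k \<ge> n0 \<Longrightarrow> norm (X n - X k) < e"
      unfolding Cauchy_iff by blast
    have "(\<Sum>l<L. (1 + (real l)\<^sup>2) * (coeff_l2w (X n) l - y l)\<^sup>2) \<le> e\<^sup>2" if n: "n \<ge> n0" for n L
    proof (rule LIMSEQ_le_const2)
      show "(\<lambda>k. \<Sum>l<L. (1 + (real l)\<^sup>2) * (coeff_l2w (X n) l - coeff_l2w (X k) l)\<^sup>2)
          \<longlonglongrightarrow> (\<Sum>l<L. (1 + (real l)\<^sup>2) * (coeff_l2w (X n) l - y l)\<^sup>2)"
        by (intro tendsto_intros lim)
      have "(\<Sum>l<L. (1 + (real l)\<^sup>2) * (coeff_l2w (X n) l - coeff_l2w (X k) l)\<^sup>2) \<le> e\<^sup>2"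
        if k: "k \<ge> n0" for k
      proof -
        have "(\<Sum>l<L. (1 + (real l)\<^sup>2) * (coeff_l2w (X n - X k) l)\<^sup>2) \<le> (norm (X n - X k))\<^sup>2"
          unfolding norm_l2w_power2 by (rule sum_le_suminf[OF summable_coeff_l2w]) auto
        also have "\<dots> \<le> e\<^sup>2"
          using n0[OF n k] by (intro power_mono) auto
        finally show ?thesis by simp
      qed
      thus "\<exists>N. \<forall>k\<ge>N. (\<Sum>l<L. (1 + (real l)\<^sup>2) * (coeff_l2w (X n) l - coeff_l2w (X k) l)\<^sup>2) \<le> e\<^sup>2"
        by blast
    qed
    thus ?thesis by blast
  qed
  have summ: "summable (\<lambda>l. (1 + (real l)\<^sup>2) * (coeff_l2w (X n) l - y l)\<^sup>2)"
    if "\<And>L. (\<Sum>l<L. (1 + (real l)\<^sup>2) * (coeff_l2w (X n) l - y l)\<^sup>2) \<le> e\<^sup>2" for n e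
    by (rule summableI_nonneg_bounded[OF _ that]) auto
  from partial[OF zero_less_one] obtain n where
    "\<And>L. (\<Sum>l<L. (1 + (real l)\<^sup>2) * (coeff_l2w (X n) l - y l)\<^sup>2) \<le> 1\<^sup>2"
    by blast
  from summ[OF this] have "summable (\<lambda>l. (1 + (real l)\<^sup>2) * (coeff_l2w (X n) l - y l)\<^sup>2)" .
  from summable_l2w_add[OF summable_coeff_l2w[of "X n"] summable_l2w_scale[OF this, of "-1"]]
  have "summable (\<lambda>l. (1 + (real l)\<^sup>2) * (y l)\<^sup>2)"
    by simp
  moreover have "y 0 = 0"
    using lim[of 0] by (simp add: LIMSEQ_const_iff)
  ultimately have y: "coeff_l2w (Abs_l2w y) = y"
    by (simp add: Abs_l2w_inverse)
  have "X \<longlonglongrightarrow> Abs_l2w y"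
  proof (rule LIMSEQ_I)
    fix e :: real assume "e > 0"
    then obtain n0 where n0: "\<And>n L. n \<ge> n0 \<Longrightarrow>
        (\<Sum>l<L. (1 + (real l)\<^sup>2) * (coeff_l2w (X n) l - y l)\<^sup>2) \<le> (e / 2)\<^sup>2"
      using partial[of "e / 2"] by auto
    have "norm (X n - Abs_l2w y) < e" if "n \<ge> n0" for n
    proof -
      have "(norm (X n - Abs_l2w y))\<^sup>2 \<le> (e / 2)\<^sup>2"
        unfolding norm_l2w_power2 coeff_l2w_minus y
        by (rule suminf_le_const[OF summ[OF n0] n0]) (use that in auto)
      hence "norm (X n - Abs_l2w y) \<le> e / 2"
        by (rule power2_le_imp_le) (use \<open>e > 0\<close> in simp)
      with \<open>e > 0\<close> show ?thesis by simp
    qed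
    thus "\<exists>no. \<forall>n\<ge>no. norm (X n - Abs_l2w y) < e" by blast
  qed
  thus "convergent X" by (rule convergentI)
qed

instance l2w :: banach ..

text \<open>The weight makes \<open>\<ell>\<^sup>2\<^sub>w\<close> embed into \<open>\<ell>\<^sup>1\<close>: pair \<open>\<bar>x\<bar>\<close> with the sequence
  \<open>1 / (1 + k\<^sup>2)\<close>, which is itself an element of the space, and use Cauchy-Schwarz.\<close>

lemma summable_abs_coeff_l2w:
  obtains K where "\<And>x. summable (\<lambda>k. \<bar>coeff_l2w x k\<bar>)" "\<And>x. (\<Sum>k. \<bar>coeff_l2w x k\<bar>) \<le> K * norm x"
proof
  define f :: "nat \<Rightarrow> real" where "f k = (if k = 0 then 0 else inverse (1 + (real k)\<^sup>2))" for k
  have "summable (\<lambda>k. inverse ((real k)\<^sup>2))"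
    by (rule inverse_power_summable) simp
  moreover have "(1 + (real k)\<^sup>2) * (f k)\<^sup>2 \<le> inverse ((real k)\<^sup>2)" for k
  proof (cases "k = 0")
    case False
    have "(1 + (real k)\<^sup>2) * (f k)\<^sup>2 = inverse (1 + (real k)\<^sup>2)"
      using False by (simp add: f_def power2_eq_square[of "inverse _"] add_pos_nonneg less_imp_neq[symmetric])
    also have "\<dots> \<le> inverse ((real k)\<^sup>2)"
      using False by (intro le_imp_inverse_le) auto
    finally show ?thesis .
  qed (simp add: f_def)
  ultimately have z: "coeff_l2w (Abs_l2w f) = f"
    by (intro l2w_dominated[where g = "\<lambda>k. inverse ((real k)\<^sup>2)"]) (simp_all add: f_def)
  fix x
  have abs: "coeff_l2w (Abs_l2w (\<lambda>k. \<bar>coeff_l2w x k\<bar>)) = (\<lambda>k. \<bar>coeff_l2w x k\<bar>)"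
    "(norm (Abs_l2w (\<lambda>k. \<bar>coeff_l2w x k\<bar>)))\<^sup>2 \<le> (norm x)\<^sup>2"
    using l2w_dominated[of "\<lambda>k. \<bar>coeff_l2w x k\<bar>", OF _ _ summable_coeff_l2w[of x]]
    by (simp_all add: norm_l2w_power2[of x])
  have eq: "(1 + (real k)\<^sup>2) * (f k * \<bar>coeff_l2w x k\<bar>) = \<bar>coeff_l2w x k\<bar>" for k
  proof -
    have "1 + (real k)\<^sup>2 > 0" by (simp add: add_pos_nonneg)
    thus ?thesis by (simp add: f_def)
  qed
  show "summable (\<lambda>k. \<bar>coeff_l2w x k\<bar>)"
    using summable_l2w_mult[OF summable_coeff_l2w[of "Abs_l2w f"]
        summable_coeff_l2w[of "Abs_l2w (\<lambda>k. \<bar>coeff_l2w x k\<bar>)"]]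
    unfolding z abs(1) eq .
  have "(\<Sum>k. \<bar>coeff_l2w x k\<bar>) = Abs_l2w f \<bullet> Abs_l2w (\<lambda>k. \<bar>coeff_l2w x k\<bar>)"
    unfolding inner_l2w.rep_eq z abs(1) eq ..
  also have "\<dots> \<le> norm (Abs_l2w f) * norm (Abs_l2w (\<lambda>k. \<bar>coeff_l2w x k\<bar>))"
    by (rule norm_cauchy_schwarz)
  also have "\<dots> \<le> norm (Abs_l2w f) * norm x"
    using abs(2) by (intro mult_left_mono) (auto intro: power2_le_imp_le)
  finally show "(\<Sum>k. \<bar>coeff_l2w x k\<bar>) \<le> norm (Abs_l2w f) * norm x" .
qed

definition diag_l2w :: "(nat \<Rightarrow> real) \<Rightarrow> l2w \<Rightarrow> l2w" where
  "diag_l2w f x = Abs_l2w (\<lambda>l. f l * coeff_l2w x l)"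

lemma
  assumes "Bseq f"
  shows coeff_diag_l2w: "coeff_l2w (diag_l2w f x) l = f l * coeff_l2w x l"
    and bounded_linear_diag_l2w: "bounded_linear (diag_l2w f)"
proof -
  obtain K where K: "K > 0" "\<And>l. \<bar>f l\<bar> \<le> K"
    using assms by (auto simp: Bseq_def)
  have *: "coeff_l2w (diag_l2w f x) = (\<lambda>l. f l * coeff_l2w x l)"
    "(norm (diag_l2w f x))\<^sup>2 \<le> (\<Sum>l. K\<^sup>2 * ((1 + (real l)\<^sup>2) * (coeff_l2w x l)\<^sup>2))" for x
  proof -
    have "(f l)\<^sup>2 \<le> K\<^sup>2" for l
      using K by (simp add: abs_le_square_iff[symmetric])
    hence "(f l)\<^sup>2 * ((1 + (real l)\<^sup>2) * (coeff_l2w x l)\<^sup>2) \<le> K\<^sup>2 * ((1 + (real l)\<^sup>2) * (coeff_l2w x l)\<^sup>2)" for l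
      by (rule mult_right_mono) simp
    hence le: "(1 + (real l)\<^sup>2) * (f l * coeff_l2w x l)\<^sup>2 \<le> K\<^sup>2 * ((1 + (real l)\<^sup>2) * (coeff_l2w x l)\<^sup>2)" for l
      by (simp add: power_mult_distrib mult_ac)
    show "coeff_l2w (diag_l2w f x) = (\<lambda>l. f l * coeff_l2w x l)"
      "(norm (diag_l2w f x))\<^sup>2 \<le> (\<Sum>l. K\<^sup>2 * ((1 + (real l)\<^sup>2) * (coeff_l2w x l)\<^sup>2))"
      using l2w_dominated[OF _ le summable_mult[OF summable_coeff_l2w]]
      by (simp_all add: diag_l2w_def)
  qed
  show coeff: "coeff_l2w (diag_l2w f x) l = f l * coeff_l2w x l" for x l
    by (simp add: *)
  show "bounded_linear (diag_l2w f)"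
  proof (rule bounded_linear_intro[where K = K])
    fix x
    have "(norm (diag_l2w f x))\<^sup>2 \<le> (norm x * K)\<^sup>2"
      using *(2)[of x] unfolding suminf_mult[OF summable_coeff_l2w] norm_l2w_power2[symmetric]
      by (simp add: power_mult_distrib mult.commute)
    thus "norm (diag_l2w f x) \<le> norm x * K"
      by (rule power2_le_imp_le) (use K in simp)
  qed (auto intro!: l2w_eqI simp: coeff algebra_simps)
qed

section \<open>The stationary equation as a nonlinear eigenvalue problem\<close>

text \<open>The contribution to \<open>conv_l2w a x y\<close> of the \<open>k\<close>-th coefficient of the second argument. The
  division by \<open>l\<close> undoes the factor \<open>l\<close> in the linear part of \<open>F\<close>; at the dummy index it gives
  the value \<open>0\<close>.\<close>

definition shift_l2w :: "(nat \<Rightarrow> real) \<Rightarrow> nat \<Rightarrow> l2w \<Rightarrow> l2w" where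
  "shift_l2w a k x = Abs_l2w (\<lambda>l.
     ((if k < l then real (l - k) * a (l - k) * coeff_l2w x (l - k) else 0)
      + (real (l + k) * a (l + k) - real k * a k) * coeff_l2w x (l + k)) / real l)"

text \<open>A bilinear map whose restriction to the diagonal \<open>x = y\<close> is, up to sign, the quadratic part of
  \<open>F\<close> divided by \<open>\<kappa> l\<close>. Writing it as a series of shift operators applied to \<open>x\<close>, instead of
  coordinatewise, reduces the Young inequality \<open>\<ell>\<^sup>1 * \<ell>\<^sup>2 \<subseteq> \<ell>\<^sup>2\<close> to absolute convergence in a Banach space.\<close>

definition conv_l2w :: "(nat \<Rightarrow> real) \<Rightarrow> l2w \<Rightarrow> l2w \<Rightarrow> l2w" where
  "conv_l2w a x y = (\<Sum>k. coeff_l2w y k *\<^sub>R shift_l2w a k x)"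

lemma sum_shifted_squares_le:
  "summable (\<lambda>l. if k < l then (coeff_l2w x (l - k))\<^sup>2 else 0)"
  "(\<Sum>l. if k < l then (coeff_l2w x (l - k))\<^sup>2 else 0) \<le> (norm x)\<^sup>2"
  "summable (\<lambda>l. (coeff_l2w x (l + k))\<^sup>2)"
  "(\<Sum>l. (coeff_l2w x (l + k))\<^sup>2) \<le> (norm x)\<^sup>2"
proof -
  let ?g = "\<lambda>l. if k < l then (coeff_l2w x (l - k))\<^sup>2 else 0"
  have g: "(\<lambda>l. ?g (l + k)) = (\<lambda>l. (coeff_l2w x l)\<^sup>2)"
    by (auto simp: fun_eq_iff)
  show summ: "summable ?g"
    using summable_coeff_l2w_power2[of x] by (subst summable_iff_shift[of _ k, symmetric]) (simp only: g)
  have "suminf ?g = (\<Sum>l. (coeff_l2w x l)\<^sup>2)"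
    by (subst suminf_split_initial_segment[OF summ, of k]) (simp only: g, simp)
  thus "suminf ?g \<le> (norm x)\<^sup>2"
    using suminf_coeff_l2w_power2_le[of x] by simp
  show "summable (\<lambda>l. (coeff_l2w x (l + k))\<^sup>2)"
    using summable_coeff_l2w_power2[of x] by (simp add: summable_iff_shift[of "\<lambda>l. (coeff_l2w x l)\<^sup>2"])
  have "(\<Sum>l. (coeff_l2w x (l + k))\<^sup>2) \<le> (\<Sum>l. (coeff_l2w x l)\<^sup>2)"
    by (subst suminf_split_initial_segment[OF summable_coeff_l2w_power2, of x k]) (simp add: sum_nonneg)
  thus "(\<Sum>l. (coeff_l2w x (l + k))\<^sup>2) \<le> (norm x)\<^sup>2"
    using suminf_coeff_l2w_power2_le[of x] by simp
qed

context
  fixes a :: "nat \<Rightarrow> real" and M :: real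
  assumes M: "\<And>l. real l * \<bar>a l\<bar> \<le> M"
begin

text \<open>For \<open>l \<ge> 1\<close> the weight \<open>1 + l\<^sup>2\<close> is at most \<open>2 l\<^sup>2\<close> and is absorbed by the division by \<open>l\<close>; the
  coefficients \<open>j a\<^sub>j\<close> are bounded by \<open>M\<close>, and translations do not increase the sum of squares. The
  resulting constant is \<open>\<surd>20 M\<close>, rounded up to \<open>5 M\<close>.\<close>

lemma
  shows coeff_shift_l2w: "coeff_l2w (shift_l2w a k x) l =
     ((if k < l then real (l - k) * a (l - k) * coeff_l2w x (l - k) else 0)
      + (real (l + k) * a (l + k) - real k * a k) * coeff_l2w x (l + k)) / real l"
    and norm_shift_l2w_le: "norm (shift_l2w a k x) \<le> 5 * M * norm x"
proof -
  have M0: "M \<ge> 0" using M[of 0] by simp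
  let ?p = "\<lambda>l. if k < l then real (l - k) * a (l - k) * coeff_l2w x (l - k) else 0"
  let ?q = "\<lambda>l. (real (l + k) * a (l + k) - real k * a k) * coeff_l2w x (l + k)"
  let ?g = "\<lambda>l. if k < l then (coeff_l2w x (l - k))\<^sup>2 else 0"
  let ?h = "\<lambda>l. (coeff_l2w x (l + k))\<^sup>2"
  have p: "(?p l)\<^sup>2 \<le> M\<^sup>2 * ?g l" for l
  proof -
    have "(real (l - k) * a (l - k))\<^sup>2 \<le> M\<^sup>2"
      using M[of "l - k"] M0 by (intro abs_le_square_iff[THEN iffD1]) (simp add: abs_mult)
    hence "(real (l - k) * a (l - k))\<^sup>2 * (coeff_l2w x (l - k))\<^sup>2 \<le> M\<^sup>2 * (coeff_l2w x (l - k))\<^sup>2"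
      by (rule mult_right_mono) simp
    thus ?thesis
      by (cases "k < l") (simp_all only: if_True if_False power_mult_distrib[of "real (l - k) * a (l - k)"], simp)
  qed
  have q: "(?q l)\<^sup>2 \<le> (2 * M)\<^sup>2 * ?h l" for l
  proof -
    have "\<bar>real (l + k) * a (l + k) - real k * a k\<bar> \<le> \<bar>real (l + k) * a (l + k)\<bar> + \<bar>real k * a k\<bar>"
      by (rule abs_triangle_ineq4)
    also have "\<dots> \<le> 2 * M"
      using M[of "l + k"] M[of k] by (simp only: abs_mult abs_of_nat)
    finally have "(real (l + k) * a (l + k) - real k * a k)\<^sup>2 \<le> (2 * M)\<^sup>2"
      using M0 by (intro abs_le_square_iff[THEN iffD1]) simp
    thus ?thesis
      by (simp only: power_mult_distrib[of "_ - _"] mult_right_mono zero_le_power2)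
  qed
  have dom: "(1 + (real l)\<^sup>2) * ((?p l + ?q l) / real l)\<^sup>2 \<le> 4 * (M\<^sup>2 * ?g l) + 4 * ((2 * M)\<^sup>2 * ?h l)" for l
  proof (cases "l = 0")
    case False
    hence l: "real l \<ge> 1" by simp
    hence "1 \<le> (real l)\<^sup>2" by simp
    hence "(1 + (real l)\<^sup>2) * (?p l + ?q l)\<^sup>2 \<le> (2 * (real l)\<^sup>2) * (?p l + ?q l)\<^sup>2"
      by (intro mult_right_mono) auto
    hence "(1 + (real l)\<^sup>2) * ((?p l + ?q l) / real l)\<^sup>2 \<le> 2 * (?p l + ?q l)\<^sup>2"
      using l by (simp add: power_divide field_simps)
    moreover have "(?p l + ?q l)\<^sup>2 \<le> 2 * (?p l)\<^sup>2 + 2 * (?q l)\<^sup>2"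
      using sum_squares_bound[of "?p l" "?q l"] unfolding power2_sum by linarith
    ultimately show ?thesis
      using p[of l] q[of l] by linarith
  qed simp
  have summ: "summable (\<lambda>l. 4 * (M\<^sup>2 * ?g l) + 4 * ((2 * M)\<^sup>2 * ?h l))"
    by (intro summable_add summable_mult sum_shifted_squares_le)
  have "(\<lambda>l. 4 * (M\<^sup>2 * ?g l) + 4 * ((2 * M)\<^sup>2 * ?h l)) sums
      (4 * (M\<^sup>2 * suminf ?g) + 4 * ((2 * M)\<^sup>2 * suminf ?h))"
    by (intro sums_add sums_mult summable_sums sum_shifted_squares_le)
  hence "(\<Sum>l. 4 * (M\<^sup>2 * ?g l) + 4 * ((2 * M)\<^sup>2 * ?h l)) =
      4 * (M\<^sup>2 * suminf ?g) + 4 * ((2 * M)\<^sup>2 * suminf ?h)"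
    by (rule sums_unique[symmetric])
  also have "\<dots> \<le> 4 * (M\<^sup>2 * (norm x)\<^sup>2) + 4 * ((2 * M)\<^sup>2 * (norm x)\<^sup>2)"
    by (intro add_mono mult_left_mono sum_shifted_squares_le) auto
  also have "\<dots> \<le> (5 * M * norm x)\<^sup>2"
    by (simp add: power_mult_distrib)
  finally have bound: "(\<Sum>l. 4 * (M\<^sup>2 * ?g l) + 4 * ((2 * M)\<^sup>2 * ?h l)) \<le> (5 * M * norm x)\<^sup>2" .
  have "(?p 0 + ?q 0) / real 0 = 0" by simp
  note * = l2w_dominated[of "\<lambda>l. (?p l + ?q l) / real l", OF this dom summ, folded shift_l2w_def]
  show "coeff_l2w (shift_l2w a k x) l = (?p l + ?q l) / real l"
    by (simp only: *(1))
  show "norm (shift_l2w a k x) \<le> 5 * M * norm x"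
    by (rule power2_le_imp_le[OF order_trans[OF *(2) bound]]) (use M0 in simp)
qed

lemma linear_shift_l2w: "linear (shift_l2w a k)"
proof (rule linearI)
  show "shift_l2w a k (x + y) = shift_l2w a k x + shift_l2w a k y" for x y
  proof (rule l2w_eqI)
    show "coeff_l2w (shift_l2w a k (x + y)) l = coeff_l2w (shift_l2w a k x + shift_l2w a k y) l" for l
      by (cases "k < l") (simp_all add: coeff_shift_l2w distrib_left add_divide_distrib)
  qed
  show "shift_l2w a k (r *\<^sub>R x) = r *\<^sub>R shift_l2w a k x" for r x
  proof (rule l2w_eqI)
    show "coeff_l2w (shift_l2w a k (r *\<^sub>R x)) l = coeff_l2w (r *\<^sub>R shift_l2w a k x) l" for l
      by (cases "k < l") (simp_all add: coeff_shift_l2w distrib_left mult_ac)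
  qed
qed

lemma summable_conv_l2w: "summable (\<lambda>k. norm (coeff_l2w y k *\<^sub>R shift_l2w a k x))"
proof -
  obtain K where K: "\<And>x. summable (\<lambda>k. \<bar>coeff_l2w x k\<bar>)" "\<And>x. (\<Sum>k. \<bar>coeff_l2w x k\<bar>) \<le> K * norm x"
    using summable_abs_coeff_l2w by blast
  show ?thesis
    by (rule summable_comparison_test'[OF summable_mult2[OF K(1)[of y], of "5 * M * norm x"], of 0])
      (simp add: mult_left_mono norm_shift_l2w_le)
qed

lemma bounded_bilinear_conv_l2w: "bounded_bilinear (conv_l2w a)"
proof
  note summ = summable_norm_cancel[OF summable_conv_l2w]
  fix x x' y y' :: l2w and r :: real
  show "conv_l2w a (x + x') y = conv_l2w a x y + conv_l2w a x' y"
    unfolding conv_l2w_def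
    by (subst suminf_add[OF summ summ]) (simp add: linear_add[OF linear_shift_l2w] scaleR_add_right)
  show "conv_l2w a x (y + y') = conv_l2w a x y + conv_l2w a x y'"
    unfolding conv_l2w_def
    by (subst suminf_add[OF summ summ]) (simp add: scaleR_add_left)
  show "conv_l2w a (r *\<^sub>R x) y = r *\<^sub>R conv_l2w a x y"
    unfolding conv_l2w_def
    by (subst suminf_scaleR_right[OF summ]) (simp add: linear_scale[OF linear_shift_l2w] mult.commute)
  show "conv_l2w a x (r *\<^sub>R y) = r *\<^sub>R conv_l2w a x y"
    unfolding conv_l2w_def by (subst suminf_scaleR_right[OF summ]) simp
next
  obtain K where K: "\<And>x. summable (\<lambda>k. \<bar>coeff_l2w x k\<bar>)" "\<And>x. (\<Sum>k. \<bar>coeff_l2w x k\<bar>) \<le> K * norm x"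
    using summable_abs_coeff_l2w by blast
  have M0: "M \<ge> 0" using M[of 0] by simp
  have "norm (conv_l2w a x y) \<le> norm x * norm y * (5 * M * K)" for x y
  proof -
    have "norm (conv_l2w a x y) \<le> (\<Sum>k. norm (coeff_l2w y k *\<^sub>R shift_l2w a k x))"
      unfolding conv_l2w_def by (rule summable_norm[OF summable_conv_l2w])
    also have "\<dots> \<le> (\<Sum>k. \<bar>coeff_l2w y k\<bar> * (5 * M * norm x))"
      by (intro suminf_le summable_conv_l2w summable_mult2 K)
        (simp add: mult_left_mono norm_shift_l2w_le)
    also have "\<dots> = (\<Sum>k. \<bar>coeff_l2w y k\<bar>) * (5 * M * norm x)"
      by (rule suminf_mult2[OF K(1), symmetric])
    also have "\<dots> \<le> (K * norm y) * (5 * M * norm x)"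
      using M0 by (intro mult_right_mono K) auto
    finally show ?thesis by (simp add: algebra_simps)
  qed
  thus "\<exists>K. \<forall>x y. norm (conv_l2w a x y) \<le> norm x * norm y * K" by blast
qed

lemma conv_l2w_basis:
  assumes "k \<ge> 1"
  shows "conv_l2w a x (basis_l2w k) = shift_l2w a k x"
proof -
  have "(\<lambda>i. coeff_l2w (basis_l2w k) i *\<^sub>R shift_l2w a i x) = (\<lambda>i. if i = k then shift_l2w a i x else 0)"
    using assms by (auto simp: fun_eq_iff basis_l2w.rep_eq)
  thus ?thesis
    unfolding conv_l2w_def by (simp add: sums_unique[OF sums_single, symmetric])
qed

lemma coeff_conv_l2w:
  "coeff_l2w (conv_l2w a x y) l = (\<Sum>k. coeff_l2w y k * coeff_l2w (shift_l2w a k x) l)"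
  unfolding conv_l2w_def
  by (subst bounded_linear.suminf[OF bounded_linear_coeff_l2w summable_norm_cancel[OF summable_conv_l2w]])
    simp

text \<open>The substitution \<open>j = l - k\<close> in the finite part and \<open>j = k + l\<close> in the infinite part of the
  series over \<open>k\<close> produces the two sums in \<open>F\<close>.\<close>

lemma coeff_conv_l2w_self:
  fixes x :: l2w
  assumes l: "l \<ge> 1"
  defines "c \<equiv> coeff_l2w x"
  shows "real l * coeff_l2w (conv_l2w a x x) l =
    (\<Sum>j\<in>{1..<l}. real j * a j * c j * c (l - j)) +
    (\<Sum>\<^sub>\<infinity>j\<in>{l<..}. (real j * a j - real (j - l) * a (j - l)) * c j * c (j - l))"
proof -
  let ?p = "\<lambda>k. if k < l then real (l - k) * a (l - k) * c (l - k) * c k else 0"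
  let ?q = "\<lambda>j. (real j * a j - real (j - l) * a (j - l)) * c j * c (j - l)"
  let ?f = "\<lambda>k. c k * coeff_l2w (shift_l2w a k x) l"
  have c0: "c 0 = 0" by (simp add: c_def)
  have split: "real l * ?f k = ?p k + ?q (k + l)" for k
  proof -
    have "real l * ?f k = c k * (real l * coeff_l2w (shift_l2w a k x) l)" by simp
    also have "real l * coeff_l2w (shift_l2w a k x) l =
        (if k < l then real (l - k) * a (l - k) * c (l - k) else 0)
        + (real (l + k) * a (l + k) - real k * a k) * c (l + k)"
      using l by (simp add: coeff_shift_l2w c_def)
    finally show ?thesis
      by (cases "k < l") (simp_all add: distrib_left add.commute[of l k] mult.commute mult.left_commute)
  qed
  have summ_f: "summable (\<lambda>k. \<bar>?f k\<bar>)"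
  proof -
    obtain K where K: "\<And>x. summable (\<lambda>k. \<bar>coeff_l2w x k\<bar>)"
      using summable_abs_coeff_l2w by blast
    have "\<bar>coeff_l2w (shift_l2w a k x) l\<bar> \<le> 5 * M * norm x" for k
      using abs_coeff_l2w_le norm_shift_l2w_le by (rule order_trans)
    thus ?thesis
      by (intro summable_comparison_test'[OF summable_mult2[OF K[of x], of "5 * M * norm x"], of 0])
        (simp add: abs_mult mult_left_mono c_def)
  qed
  have p: "?p sums (\<Sum>k<l. ?p k)"
    by (rule sums_finite) auto
  have pf: "summable (\<lambda>k. \<bar>?p k\<bar>)"
    by (rule summable_finite[of "{..<l}"]) auto
  have q_eq: "?q (k + l) = real l * ?f k - ?p k" for k
    using split[of k] by simp
  have qf: "summable (\<lambda>k. \<bar>?q (k + l)\<bar>)"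
  proof (rule summable_comparison_test'[OF summable_add[OF summable_mult[OF summ_f, of "real l"] pf], of 0])
    show "norm \<bar>?q (k + l)\<bar> \<le> real l * \<bar>?f k\<bar> + \<bar>?p k\<bar>" for k
      unfolding q_eq using abs_triangle_ineq4[of "real l * ?f k" "?p k"] by (simp add: abs_mult)
  qed
  have "real l * coeff_l2w (conv_l2w a x x) l = (\<Sum>k. real l * ?f k)"
    using suminf_mult[OF summable_rabs_cancel[OF summ_f], of "real l"] by (simp add: coeff_conv_l2w c_def)
  also have "\<dots> = (\<Sum>k. ?p k + ?q (k + l))"
    by (simp only: split)
  also have "\<dots> = (\<Sum>k. ?p k) + (\<Sum>k. ?q (k + l))"
    by (intro suminf_add[symmetric] sums_summable[OF p] summable_rabs_cancel[OF qf])
  also have "(\<Sum>k. ?p k) = (\<Sum>k<l. ?p k)"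
    using p by (rule sums_unique[symmetric])
  also have "\<dots> = (\<Sum>k\<in>{1..<l}. ?p k)"
    by (rule sum.mono_neutral_right) (auto simp: c0 not_less_eq_eq)
  also have "\<dots> = (\<Sum>j\<in>{1..<l}. real j * a j * c j * c (l - j))"
    by (rule sum.reindex_bij_witness[where i = "\<lambda>j. l - j" and j = "\<lambda>j. l - j"]) auto
  also have "(\<Sum>k. ?q (k + l)) = (\<Sum>\<^sub>\<infinity>k. ?q (k + l))"
    using norm_summable_imp_has_sum[of "\<lambda>k. ?q (k + l)", OF _ summable_sums] qf
    by (intro infsumI[symmetric]) (auto intro: summable_rabs_cancel)
  also have "\<dots> = (\<Sum>\<^sub>\<infinity>k\<in>{0<..}. ?q (k + l))"
    by (rule infsum_cong_neutral) (auto simp: c0)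
  also have "\<dots> = (\<Sum>\<^sub>\<infinity>j\<in>{l<..}. ?q j)"
    by (rule infsum_reindex_bij_betw)
      (rule bij_betw_byWitness[where f' = "\<lambda>j. j - l"]; force)
  finally show ?thesis .
qed

text \<open>Dividing \<open>F\<^sub>l = 0\<close> by \<open>\<kappa> l\<close> turns the stationary equation into a nonlinear eigenvalue
  problem with eigenvalue parameter \<open>2 / \<kappa>\<close> and linear part \<open>diag(a\<^sub>l)\<close>.\<close>

lemma is_solution_iff:
  assumes "Bseq a"
  shows "is_solution a x \<kappa> \<longleftrightarrow> \<kappa> > 0 \<and> (2 / \<kappa>) *\<^sub>R x = diag_l2w a x + conv_l2w a x x"
proof -
  have F: "F a x \<kappa> l = \<kappa> * real l * (2 / \<kappa> * coeff_l2w x l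
      - (a l * coeff_l2w x l + coeff_l2w (conv_l2w a x x) l))" if "l \<ge> 1" "\<kappa> > 0" for l
  proof -
    have "F a x \<kappa> l = real l * (2 - \<kappa> * a l) * coeff_l2w x l
        - \<kappa> * (real l * coeff_l2w (conv_l2w a x x) l)"
      unfolding coeff_conv_l2w_self[OF that(1)] F_def Let_def by (simp add: algebra_simps)
    moreover have "\<kappa> * (2 / \<kappa> * coeff_l2w x l) = 2 * coeff_l2w x l"
      using that by simp
    ultimately show ?thesis
      by (simp only: right_diff_distrib mult.assoc mult.left_commute[of "\<kappa>" "real l"]) (simp add: algebra_simps)
  qed
  have "(\<forall>l\<ge>1. F a x \<kappa> l = 0) \<longleftrightarrow> (2 / \<kappa>) *\<^sub>R x = diag_l2w a x + conv_l2w a x x" if \<kappa>: "\<kappa> > 0"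
  proof
    assume F0: "\<forall>l\<ge>1. F a x \<kappa> l = 0"
    show "(2 / \<kappa>) *\<^sub>R x = diag_l2w a x + conv_l2w a x x"
    proof (rule l2w_eqI)
      fix l :: nat assume l: "l \<ge> 1"
      with F0 F[OF l \<kappa>] \<kappa> have "2 / \<kappa> * coeff_l2w x l
          - (a l * coeff_l2w x l + coeff_l2w (conv_l2w a x x) l) = 0" by auto
      thus "coeff_l2w ((2 / \<kappa>) *\<^sub>R x) l = coeff_l2w (diag_l2w a x + conv_l2w a x x) l"
        by (simp add: coeff_diag_l2w[OF assms])
    qed
  next
    assume eq: "(2 / \<kappa>) *\<^sub>R x = diag_l2w a x + conv_l2w a x x"
    have "2 / \<kappa> * coeff_l2w x l = a l * coeff_l2w x l + coeff_l2w (conv_l2w a x x) l" for l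
      using arg_cong[OF eq, of "\<lambda>x. coeff_l2w x l"] by (simp add: coeff_diag_l2w[OF assms])
    thus "\<forall>l\<ge>1. F a x \<kappa> l = 0"
      using \<kappa> by (simp add: F)
  qed
  thus ?thesis
    unfolding is_solution_def by blast
qed

end

section \<open>Pitchfork bifurcation of stationary states\<close>

lemma coeff_basis_l2w: "k \<ge> 1 \<Longrightarrow> coeff_l2w (basis_l2w k) l = (if l = k then 1 else 0)"
  by (simp add: basis_l2w.rep_eq)

lemma fourier_decay_imp_tendsto_0:
  assumes "\<And>l. real l * \<bar>a l\<bar> \<le> M"
  shows "a \<longlonglongrightarrow> 0"
proof (rule Lim_null_comparison)
  show "(\<lambda>l. M / real l) \<longlonglongrightarrow> 0"
    by (rule lim_const_over_n)
  show "\<forall>\<^sub>F l in sequentially. norm (a l) \<le> M / real l"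
    using eventually_gt_at_top[of 0]
    by eventually_elim (use assms in \<open>simp add: field_simps\<close>)
qed

lemma filterlim_inverse_parameter:
  fixes c :: real
  assumes "c \<noteq> 0"
  shows "filterlim (\<lambda>z. (fst z, 2 / snd z)) (nhds (x, 2 / c)) (nhds (x :: 'a::t2_space, c))"
proof -
  let ?f = "\<lambda>z :: 'a \<times> real. (fst z, 2 / snd z)"
  have "isCont ?f (x, c)"
    using assms by (intro continuous_intros) auto
  thus ?thesis
    unfolding isCont_def using tendsto_at_iff_tendsto_nhds[of ?f "(x, c)"] by simp
qed

theorem theorem2p2:
  fixes W :: "real \<Rightarrow> real" and a :: "nat \<Rightarrow> real" and lstar :: nat
  assumes "even_L2_potential W a"
    and "bdd_above ((\<lambda>l. real l * \<bar>a l\<bar>) ` {1..})"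
    and "lstar \<ge> 1" and "a lstar > 0"
    and "\<And>l. l \<ge> 1 \<Longrightarrow> l \<noteq> lstar \<Longrightarrow> a l \<noteq> a lstar"
  shows "(\<exists>\<delta>>0. \<exists>(p :: real \<Rightarrow> l2w) (\<kappa> :: real \<Rightarrow> real).
      nontrivial_branch a 0 (2 / a lstar) \<delta> p \<kappa> \<and>
      (\<lambda>s. norm (p s - s *\<^sub>R basis_l2w lstar)) \<in> o[at 0](\<lambda>s. s) \<and>
      (\<forall>s\<in>{-\<delta><..<\<delta>}. \<kappa> differentiable (at s) \<and> deriv \<kappa> differentiable (at s)) \<and>
      \<kappa> 0 = 2 / a lstar \<and> deriv \<kappa> 0 = 0 \<and>
      deriv (deriv \<kappa>) 0 =
        2 / a lstar * ((a lstar - 2 * a (2 * lstar)) / (a lstar - a (2 * lstar))) \<and>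
      (\<exists>U. open U \<and> (0, 2 / a lstar) \<in> U \<and>
        {(q, k) \<in> U. is_solution a q k \<and> q \<noteq> 0} =
        {(p s, \<kappa> s) | s. s \<in> {-\<delta><..<\<delta>} \<and> p s \<noteq> 0} \<inter> U)) \<and>
    (\<forall>k>0. k \<notin> {2 / a l | l. l \<ge> 1} \<longrightarrow> \<not> bifurcation_point a 0 k)"
proof -
  let ?A = "a lstar" and ?e = "basis_l2w lstar"
  note m = \<open>lstar \<ge> 1\<close> and A = \<open>?A > 0\<close>
  obtain M where M: "\<And>l. real l * \<bar>a l\<bar> \<le> M"
  proof -
    obtain M where "real l * \<bar>a l\<bar> \<le> M" if "l \<ge> 1" for l
      using assms(2) by (auto simp: bdd_above_def)
    hence "real l * \<bar>a l\<bar> \<le> max M 0" for l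
      by (cases "l = 0") (auto simp: le_max_iff_disj)
    thus ?thesis by (rule that)
  qed
  note a_0 = fourier_decay_imp_tendsto_0[OF M]
  note Bseq_a = convergent_imp_Bseq[OF convergentI[OF a_0]]
  note sol_iff = is_solution_iff[OF M Bseq_a]
  note bilinear = bounded_bilinear_conv_l2w[OF M]
  \<comment> \<open>The multiplier of the reduced resolvent of \<open>diag(a\<^sub>l)\<close> at \<open>a lstar\<close>; it is bounded because
    \<open>a l \<longlonglongrightarrow> 0\<close> while \<open>a lstar > 0\<close>.\<close>
  define T where "T l = (if l = lstar then 0 else 1 / (?A - a l))" for l
  have "T \<longlonglongrightarrow> 1 / (?A - 0)"
  proof (rule Lim_transform_eventually)
    show "(\<lambda>l. 1 / (?A - a l)) \<longlonglongrightarrow> 1 / (?A - 0)"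
      using A by (intro tendsto_intros a_0) auto
    show "\<forall>\<^sub>F l in sequentially. 1 / (?A - a l) = T l"
      using eventually_gt_at_top[of lstar] by eventually_elim (simp add: T_def)
  qed
  hence Bseq_T: "Bseq T"
    by (intro convergent_imp_Bseq convergentI)
  have T: "(?A - a l) * T l = (if l = lstar then 0 else 1)" if "l \<ge> 1" for l
    using assms(5)[OF that] by (cases "l = lstar") (auto simp: T_def)
  have m2: "2 * lstar \<ge> 1" using m by simp
  note basis = coeff_basis_l2w[OF m] coeff_basis_l2w[OF m2]
  note conv_basis = conv_l2w_basis[OF M m] conv_l2w_basis[OF M m2]
  note coeff_diag = coeff_diag_l2w[OF Bseq_a] coeff_diag_l2w[OF Bseq_T]
  interpret simple_eigenvalue "diag_l2w a" "diag_l2w T" "\<lambda>x. coeff_l2w x lstar" "conv_l2w a" ?e ?A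
  proof (intro simple_eigenvalue.intro simple_eigenvalue_axioms.intro bilinear
      bounded_linear_diag_l2w Bseq_a Bseq_T bounded_linear_coeff_l2w)
    show "diag_l2w a ?e = ?A *\<^sub>R ?e"
      by (rule l2w_eqI) (simp add: coeff_diag basis)
    show "coeff_l2w (diag_l2w T x) lstar = 0" for x
      by (simp add: coeff_diag T_def)
    show "diag_l2w T (?A *\<^sub>R x - diag_l2w a x) = x - coeff_l2w x lstar *\<^sub>R ?e" for x
    proof (rule l2w_eqI)
      fix l :: nat assume "l \<ge> 1"
      have "coeff_l2w (diag_l2w T (?A *\<^sub>R x - diag_l2w a x)) l = ((?A - a l) * T l) * coeff_l2w x l"
        by (simp add: coeff_diag algebra_simps)
      thus "coeff_l2w (diag_l2w T (?A *\<^sub>R x - diag_l2w a x)) l = coeff_l2w (x - coeff_l2w x lstar *\<^sub>R ?e) l"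
        using T[OF \<open>l \<ge> 1\<close>] by (simp add: basis)
    qed
    show "?A *\<^sub>R diag_l2w T x - diag_l2w a (diag_l2w T x) = x - coeff_l2w x lstar *\<^sub>R ?e" for x
    proof (rule l2w_eqI)
      fix l :: nat assume "l \<ge> 1"
      have "coeff_l2w (?A *\<^sub>R diag_l2w T x - diag_l2w a (diag_l2w T x)) l = ((?A - a l) * T l) * coeff_l2w x l"
        by (simp add: coeff_diag algebra_simps)
      thus "coeff_l2w (?A *\<^sub>R diag_l2w T x - diag_l2w a (diag_l2w T x)) l
          = coeff_l2w (x - coeff_l2w x lstar *\<^sub>R ?e) l"
        using T[OF \<open>l \<ge> 1\<close>] by (simp add: basis)
    qed
  qed (auto simp: coeff_diag basis)
  obtain \<delta>\<^sub>0 u lam lam' where \<delta>\<^sub>0: "\<delta>\<^sub>0 > 0" and u0: "u 0 = ?e" and lam0: "lam 0 = ?A"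
    and u1: "\<And>s. \<bar>s\<bar> < \<delta>\<^sub>0 \<Longrightarrow> coeff_l2w (u s) lstar = 1"
    and contu: "\<And>s. \<bar>s\<bar> < \<delta>\<^sub>0 \<Longrightarrow> isCont u s"
    and sol: "\<And>s. \<bar>s\<bar> < \<delta>\<^sub>0 \<Longrightarrow> lam s *\<^sub>R (s *\<^sub>R u s) =
        diag_l2w a (s *\<^sub>R u s) + conv_l2w a (s *\<^sub>R u s) (s *\<^sub>R u s)"
    and dlam: "\<And>s. \<bar>s\<bar> < \<delta>\<^sub>0 \<Longrightarrow> (lam has_real_derivative lam' s) (at s)"
    and dlam': "\<And>s. \<bar>s\<bar> < \<delta>\<^sub>0 \<Longrightarrow> lam' differentiable (at s)"
    and lam'0: "lam' 0 = coeff_l2w (conv_l2w a ?e ?e) lstar"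
    and dlam'0: "(lam' has_real_derivative
        2 * coeff_l2w (conv_l2w a ?e (branch_map ?e) + conv_l2w a (branch_map ?e) ?e) lstar) (at 0)"
    and uniq: "\<forall>\<^sub>F (x, \<mu>) in nhds (0, ?A). \<mu> *\<^sub>R x = diag_l2w a x + conv_l2w a x x \<longrightarrow> x \<noteq> 0 \<longrightarrow>
        x = coeff_l2w x lstar *\<^sub>R u (coeff_l2w x lstar) \<and> \<mu> = lam (coeff_l2w x lstar)"
    by (rule bifurcating_branch, rule that)
  \<comment> \<open>The mode \<open>lstar\<close> interacts with itself only in the mode \<open>2 lstar\<close>, which gives
    \<open>\<kappa>'(0) = 0\<close>; the interaction of these two modes has a component along \<open>lstar\<close>, which gives
    \<open>\<kappa>''(0)\<close>.\<close>
  have ee: "conv_l2w a ?e ?e = (?A / 2) *\<^sub>R basis_l2w (2 * lstar)"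
  proof (rule l2w_eqI)
    fix l :: nat assume "l \<ge> 1"
    thus "coeff_l2w (conv_l2w a ?e ?e) l = coeff_l2w ((?A / 2) *\<^sub>R basis_l2w (2 * lstar)) l"
      using m by (auto simp: conv_basis coeff_shift_l2w[OF M] basis)
  qed
  have e2: "coeff_l2w (conv_l2w a ?e (basis_l2w (2 * lstar))) lstar = 0"
    "coeff_l2w (conv_l2w a (basis_l2w (2 * lstar)) ?e) lstar = 2 * a (2 * lstar) - ?A"
    using m by (simp_all add: conv_basis coeff_shift_l2w[OF M] basis mult_2[symmetric]
        diff_divide_distrib)
  have lam'0: "lam' 0 = 0"
    using m by (simp add: lam'0 ee basis)
  define \<Lambda> where "\<Lambda> = ?A * (2 * a (2 * lstar) - ?A) / (?A - a (2 * lstar))"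
  have ne: "a (2 * lstar) \<noteq> ?A"
    using assms(5)[of "2 * lstar"] m by simp
  have Pe: "branch_map ?e = (?A / 2 / (?A - a (2 * lstar))) *\<^sub>R basis_l2w (2 * lstar)"
  proof (rule l2w_eqI)
    fix l :: nat assume "l \<ge> 1"
    thus "coeff_l2w (branch_map ?e) l = coeff_l2w ((?A / 2 / (?A - a (2 * lstar))) *\<^sub>R basis_l2w (2 * lstar)) l"
      using m ne by (simp add: branch_map_def coeff_diag ee basis T_def) (simp add: field_simps)
  qed
  have "2 * coeff_l2w (conv_l2w a ?e (branch_map ?e) + conv_l2w a (branch_map ?e) ?e) lstar = \<Lambda>"
    using ne by (simp add: Pe N.scaleR_left N.scaleR_right e2 \<Lambda>_def) (simp add: field_simps)
  hence dlam'0: "(lam' has_real_derivative \<Lambda>) (at 0)"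
    using dlam'0 by (simp only:)
  have "isCont lam 0"
    using dlam[of 0] \<delta>\<^sub>0 DERIV_isCont by auto
  hence "(lam \<longlongrightarrow> lam 0) (nhds 0)"
    by (simp only: isCont_def tendsto_at_iff_tendsto_nhds)
  hence "\<forall>\<^sub>F s in nhds 0. lam s > 0"
    by (rule order_tendstoD) (simp add: lam0 A)
  then obtain d where d: "d > 0" "\<And>s. \<bar>s\<bar> < d \<Longrightarrow> lam s > 0"
    by (auto simp: eventually_nhds_metric dist_real_def)
  \<comment> \<open>Shrinking the interval keeps \<open>lam\<close> positive, so that \<open>\<kappa> = 2 / lam\<close> is positive and
    inherits the derivatives of \<open>lam\<close>.\<close>
  define \<delta> where "\<delta> = min \<delta>\<^sub>0 d"
  have \<delta>: "\<delta> > 0" "\<And>s. \<bar>s\<bar> < \<delta> \<Longrightarrow> \<bar>s\<bar> < \<delta>\<^sub>0" and lam_pos: "\<And>s. \<bar>s\<bar> < \<delta> \<Longrightarrow> lam s > 0"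
    using \<delta>\<^sub>0 d by (auto simp: \<delta>_def)
  define p where "p s = s *\<^sub>R u s" for s
  define \<kappa> where "\<kappa> s = 2 / lam s" for s
  define \<kappa>' where "\<kappa>' s = - 2 * lam' s / (lam s)\<^sup>2" for s
  have d\<kappa>: "(\<kappa> has_real_derivative \<kappa>' s) (at s)" if s: "\<bar>s\<bar> < \<delta>" for s
    unfolding \<kappa>_def[abs_def] \<kappa>'_def using lam_pos[OF s]
    by (auto intro!: derivative_eq_intros dlam \<delta>(2)[OF s] simp: power2_eq_square)
  have deriv\<kappa>: "\<forall>\<^sub>F r in nhds s. \<kappa>' r = deriv \<kappa> r" if s: "\<bar>s\<bar> < \<delta>" for s
  proof (rule eventually_mono)
    show "\<forall>\<^sub>F r in nhds s. \<bar>r\<bar> < \<delta>"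
      using s by (intro eventually_nhds_less continuous_intros)
  qed (rule DERIV_imp_deriv[OF d\<kappa>, symmetric])
  have d\<kappa>': "(\<kappa>' has_real_derivative - ((2 * D * (lam s)\<^sup>2 - 4 * (lam' s)\<^sup>2 * lam s) / (lam s) ^ 4)) (at s)"
    if s: "\<bar>s\<bar> < \<delta>" and D: "(lam' has_real_derivative D) (at s)" for s D
    unfolding \<kappa>'_def[abs_def] using lam_pos[OF s]
    by (auto intro!: derivative_eq_intros dlam \<delta>(2)[OF s] D simp: power2_eq_square power4_eq_xxxx algebra_simps)
  have deriv_\<kappa>': "(deriv \<kappa> has_real_derivative - ((2 * D * (lam s)\<^sup>2 - 4 * (lam' s)\<^sup>2 * lam s) / (lam s) ^ 4)) (at s)"
    if s: "\<bar>s\<bar> < \<delta>" and D: "(lam' has_real_derivative D) (at s)" for s D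
    using d\<kappa>'[OF that] DERIV_cong_ev[OF refl deriv\<kappa>[OF s] refl] by simp
  have "nontrivial_branch a 0 (2 / ?A) \<delta> p \<kappa>"
    unfolding nontrivial_branch_def bifurcation_curve_def
  proof (intro conjI ballI impI)
    show "continuous_on {-\<delta><..<\<delta>} (\<lambda>s. (p s, \<kappa> s))"
    proof (intro continuous_at_imp_continuous_on ballI)
      fix s assume "s \<in> {-\<delta><..<\<delta>}"
      hence s: "\<bar>s\<bar> < \<delta>" by auto
      have "isCont p s"
        unfolding p_def[abs_def] by (intro continuous_intros contu \<delta>(2) s)
      moreover have "isCont \<kappa> s"
        using d\<kappa>[OF s] by (rule DERIV_isCont)
      ultimately show "isCont (\<lambda>s. (p s, \<kappa> s)) s"
        by (rule isCont_Pair)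
    qed
    show "p 0 = 0" "\<kappa> 0 = 2 / ?A"
      by (simp_all add: p_def \<kappa>_def lam0)
    show "is_solution a (p s) (\<kappa> s)" if "s \<in> {-\<delta><..<\<delta>}" for s
    proof -
      have s: "\<bar>s\<bar> < \<delta>" using that by auto
      show ?thesis
        using sol[OF \<delta>(2)[OF s]] lam_pos[OF s] by (simp add: sol_iff p_def \<kappa>_def)
    qed
    have p0: "s = 0" if "s \<in> {-\<delta><..<\<delta>}" "p s = 0" for s
    proof -
      have "s * coeff_l2w (u s) lstar = 0"
        using arg_cong[OF that(2), of "\<lambda>x. coeff_l2w x lstar"] by (simp add: p_def)
      thus ?thesis using u1[of s] \<delta>(2)[of s] that(1) by auto
    qed
    show "s = t" if "s \<in> {-\<delta><..<\<delta>}" "t \<in> {-\<delta><..<\<delta>}" "p s = 0" "p t = 0" for s t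
      using p0 that by metis
  qed
  moreover have "(\<lambda>s. norm (p s - s *\<^sub>R ?e)) \<in> o[at 0](\<lambda>s. s)"
  proof (rule smalloI_tendsto)
    have "((\<lambda>s. norm (u s - ?e)) \<longlongrightarrow> norm (u 0 - ?e)) (at 0)"
      using contu[of 0] \<delta>\<^sub>0 unfolding isCont_def by (intro tendsto_intros) auto
    hence "((\<lambda>s. norm (u s - ?e)) \<longlongrightarrow> 0) (at 0)"
      by (simp add: u0)
    hence "((\<lambda>s. \<bar>norm (p s - s *\<^sub>R ?e) / s\<bar>) \<longlongrightarrow> 0) (at 0)"
    proof (rule Lim_transform_eventually)
      show "\<forall>\<^sub>F s in at 0. norm (u s - ?e) = \<bar>norm (p s - s *\<^sub>R ?e) / s\<bar>"
        using eventually_neq_at_within[of 0]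
      proof eventually_elim
        case (elim s)
        have "p s - s *\<^sub>R ?e = s *\<^sub>R (u s - ?e)" by (simp add: p_def scaleR_diff_right)
        thus ?case using elim by simp
      qed
    qed
    thus "((\<lambda>s. norm (p s - s *\<^sub>R ?e) / s) \<longlongrightarrow> 0) (at 0)"
      by (rule tendsto_rabs_zero_cancel)
    show "\<forall>\<^sub>F s in at (0::real). s \<noteq> 0"
      by (rule eventually_neq_at_within)
  qed
  moreover have "\<kappa> differentiable (at s) \<and> deriv \<kappa> differentiable (at s)" if "s \<in> {-\<delta><..<\<delta>}" for s
  proof
    have s: "\<bar>s\<bar> < \<delta>" using that by auto
    show "\<kappa> differentiable (at s)"
      using d\<kappa>[OF s] by (auto simp: real_differentiable_def)
    from dlam'[OF \<delta>(2)[OF s]] obtain D where "(lam' has_real_derivative D) (at s)"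
      by (auto simp: real_differentiable_def)
    from deriv_\<kappa>'[OF s this] show "deriv \<kappa> differentiable (at s)"
      by (auto simp: real_differentiable_def)
  qed
  moreover have "\<kappa> 0 = 2 / ?A"
    by (simp add: \<kappa>_def lam0)
  moreover have "deriv \<kappa> 0 = 0"
    using DERIV_imp_deriv[OF d\<kappa>[of 0]] \<delta> by (simp add: \<kappa>'_def lam'0)
  moreover have "deriv (deriv \<kappa>) 0 = 2 / ?A * ((?A - 2 * a (2 * lstar)) / (?A - a (2 * lstar)))"
  proof -
    have "deriv (deriv \<kappa>) 0 = - ((2 * \<Lambda> * ?A\<^sup>2) / ?A ^ 4)"
      using DERIV_imp_deriv[OF deriv_\<kappa>'[OF _ dlam'0]] \<delta> by (simp add: lam0 lam'0)
    also have "\<dots> = 2 / ?A * ((?A - 2 * a (2 * lstar)) / (?A - a (2 * lstar)))"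
      using A ne
      by (simp add: \<Lambda>_def divide_simps power2_eq_square power4_eq_xxxx)
    finally show ?thesis .
  qed
  moreover have "\<exists>U. open U \<and> (0, 2 / ?A) \<in> U \<and>
      {(q, k) \<in> U. is_solution a q k \<and> q \<noteq> 0} =
      {(p s, \<kappa> s) | s. s \<in> {-\<delta><..<\<delta>} \<and> p s \<noteq> 0} \<inter> U"
  proof -
    \<comment> \<open>Uniqueness is known in the variables \<open>(x, 2 / \<kappa>)\<close> near \<open>(0, a lstar)\<close>; it is pulled back
      along the continuous change of parameter.\<close>
    have lim: "filterlim (\<lambda>z. (fst z, 2 / snd z)) (nhds (0 :: l2w, ?A)) (nhds (0, 2 / ?A))"
      using filterlim_inverse_parameter[of "2 / ?A" "0 :: l2w"] A by simp
    have "\<forall>\<^sub>F z in nhds (0, 2 / ?A). \<bar>coeff_l2w (fst z) lstar\<bar> < \<delta>"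
      using \<delta> by (intro eventually_nhds_less continuous_intros
          bounded_linear.continuous_on[OF bounded_linear_coeff_l2w]) auto
    with eventually_compose_filterlim[OF uniq lim]
    have "\<forall>\<^sub>F z in nhds (0, 2 / ?A). is_solution a (fst z) (snd z) \<and> fst z \<noteq> 0 \<longrightarrow>
        (\<exists>s. \<bar>s\<bar> < \<delta> \<and> z = (p s, \<kappa> s))"
    proof eventually_elim
      case (elim z)
      obtain x k where z: "z = (x, k)" by force
      have "\<exists>s. \<bar>s\<bar> < \<delta> \<and> z = (p s, \<kappa> s)" if x: "is_solution a x k" "x \<noteq> 0"
      proof -
        have k: "k > 0" "(2 / k) *\<^sub>R x = diag_l2w a x + conv_l2w a x x"
          using x by (simp_all add: sol_iff)
        define s where "s = coeff_l2w x lstar"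
        have s: "x = s *\<^sub>R u s" "2 / k = lam s"
          using elim(1) k x unfolding z s_def by auto
        have "\<kappa> s = k"
          using k(1) by (simp add: \<kappa>_def s(2)[symmetric])
        moreover have "\<bar>s\<bar> < \<delta>"
          using elim(2) by (simp add: z s_def)
        ultimately show ?thesis
          using s(1) by (auto simp: z p_def)
      qed
      thus ?case by (simp add: z)
    qed
    then obtain U where U: "open U" "(0, 2 / ?A) \<in> U"
      and U': "\<And>z. z \<in> U \<Longrightarrow> is_solution a (fst z) (snd z) \<Longrightarrow> fst z \<noteq> 0 \<Longrightarrow>
        \<exists>s. \<bar>s\<bar> < \<delta> \<and> z = (p s, \<kappa> s)"
      by (auto simp: eventually_nhds)
    have "is_solution a (p s) (\<kappa> s)" if "s \<in> {-\<delta><..<\<delta>}" for s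
      using calculation that by (auto simp: nontrivial_branch_def bifurcation_curve_def)
    hence "{(q, k) \<in> U. is_solution a q k \<and> q \<noteq> 0} =
        {(p s, \<kappa> s) | s. s \<in> {-\<delta><..<\<delta>} \<and> p s \<noteq> 0} \<inter> U"
      using U' by (fastforce simp: abs_less_iff)
    with U show ?thesis by blast
  qed
  moreover have "\<not> bifurcation_point a 0 k" if k: "k > 0" "k \<notin> {2 / a l | l. l \<ge> 1}" for k
  proof -
    \<comment> \<open>The numbers \<open>2 / k - a\<^sub>l\<close> are nonzero for \<open>l \<ge> 1\<close> and tend to \<open>2 / k\<close>, so their reciprocals
      form a bounded sequence and define the resolvent at \<open>2 / k\<close>.\<close>
    define R where "R l = 1 / (2 / k - a l)" for l
    have "R \<longlonglongrightarrow> 1 / (2 / k - 0)"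
      unfolding R_def using k by (intro tendsto_intros a_0) auto
    hence Bseq_R: "Bseq R"
      by (intro convergent_imp_Bseq convergentI)
    have inv: "diag_l2w R ((2 / k) *\<^sub>R x - diag_l2w a x) = x" for x
    proof (rule l2w_eqI)
      fix l :: nat assume "l \<ge> 1"
      have "2 / k - a l \<noteq> 0"
      proof
        assume "2 / k - a l = 0"
        hence "a l = 2 / k" by simp
        hence "k = 2 / a l" using k(1) by simp
        with k(2) \<open>l \<ge> 1\<close> show False by blast
      qed
      hence "R l * (2 / k - a l) = 1"
        by (simp add: R_def)
      moreover have "coeff_l2w (diag_l2w R ((2 / k) *\<^sub>R x - diag_l2w a x)) l =
          (R l * (2 / k - a l)) * coeff_l2w x l"
        by (simp add: coeff_diag_l2w[OF Bseq_R] coeff_diag_l2w[OF Bseq_a] algebra_simps)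
      ultimately show "coeff_l2w (diag_l2w R ((2 / k) *\<^sub>R x - diag_l2w a x)) l = coeff_l2w x l"
        by simp
    qed
    note ev = eventually_only_trivial_solution[OF bilinear bounded_linear_diag_l2w[OF Bseq_R] inv]
    have "k \<noteq> 0" using k by simp
    from eventually_compose_filterlim[OF ev filterlim_inverse_parameter[OF this]]
    have "\<forall>\<^sub>F z in nhds (0, k). is_solution a (fst z) (snd z) \<longrightarrow> fst z = 0"
      by eventually_elim (auto simp: sol_iff)
    then obtain U where U: "open U" "(0, k) \<in> U"
      and U': "\<And>z. z \<in> U \<Longrightarrow> is_solution a (fst z) (snd z) \<Longrightarrow> fst z = 0"
      by (auto simp: eventually_nhds)
    show ?thesis
    proof
      assume "bifurcation_point a 0 k"
      hence "(0, k) \<in> closure {(q, k'). is_solution a q k' \<and> q \<noteq> 0 \<and> k' \<noteq> k}"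
        by (simp add: bifurcation_point_def)
      then obtain z where "z \<in> {(q, k'). is_solution a q k' \<and> q \<noteq> 0 \<and> k' \<noteq> k}" "z \<in> U"
        using U open_Int_closure_eq_empty[OF U(1)] by blast
      with U'[of z] show False by auto
    qed
  qed
  ultimately show ?thesis
    using \<delta>(1) by blast
qed

end
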